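(* For every fixed integer $r \ge 5$, as $n \to \infty$, \[ \mathrm{ex}(n, K_{r,r}) = \Omega\Big(n^{2-2/(r+1)}\,(\ln\ln n)^{1/(r^2-1)}\Big). \]
   Context: $\mathrm{ex}(n,H)$ denotes the largest integer $m$ such that there exists a graph on $n$ vertices with $m$ edges containing no (not necessarily induced) subgraph isomorphic to $H$. $K_{r,r}$ is the complete bipartite graph with both parts of size $r$. The implied constant may depend on $r$. *)

theory Defs
  imports Complex_Main "HOL-Library.Landau_Symbols"
begin

definition simple_graph_on :: "nat \<Rightarrow> (nat \<Rightarrow> nat \<Rightarrow> bool) \<Rightarrow> bool" where
  "simple_graph_on n E \<longleftrightarrow>
     (\<forall>x y. E x y \<longrightarrow> E y x) \<and> (\<forall>x. \<not> E x x) \<and> (\<forall>x y. E x y \<longrightarrow> x < n \<and> y < n)"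

definition graph_edges :: "nat \<Rightarrow> (nat \<Rightarrow> nat \<Rightarrow> bool) \<Rightarrow> nat set set" where
  "graph_edges n E = {{x, y} | x y. x < n \<and> y < n \<and> E x y}"

definition contains_Krr :: "nat \<Rightarrow> (nat \<Rightarrow> nat \<Rightarrow> bool) \<Rightarrow> nat \<Rightarrow> bool" where
  "contains_Krr n E r \<longleftrightarrow>
     (\<exists>A B. A \<subseteq> {..<n} \<and> B \<subseteq> {..<n} \<and> A \<inter> B = {} \<and> card A = r \<and> card B = r \<and>
            (\<forall>a\<in>A. \<forall>b\<in>B. E a b))"

definition ex_Krr :: "nat \<Rightarrow> nat \<Rightarrow> nat" where
  "ex_Krr n r = Max {card (graph_edges n E) | E. simple_graph_on n E \<and> \<not> contains_Krr n E r}"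

end

theory Submission
  imports Defs "HOL-Probability.Probability" "HOL-Real_Asymp.Real_Asymp"
begin

text \<open>Work in a bipartite host graph, so that copies of \<open>K\<^bsub>r,r\<^esub>\<close> are \<open>r \<times> r\<close> rectangles of cells in
  \<open>{..<N} \<times> {..<N}\<close>, the hyperedges of an \<open>r\<^sup>2\<close>-uniform hypergraph. Put \<open>M \<approx> sqrt (ln N)\<close>. A random set of
  cells of density \<open>(M / 2) N\<^bsup>-2/(r+1)\<^esup>\<close>, after a first-moment deletion, spans a hypergraph of maximum
  degree at most \<open>M\<^bsup>r^2-1\<^esup>\<close> without cycles of at most \<open>2 M\<close> hyperedges; the saving in the expected number
  of short cycles comes from \<open>K\<^bsub>r,r\<^esub>\<close> being strictly 2-balanced.

  On such a hypergraph run the random greedy algorithm with \<open>M\<close> rounds, giving each cell a uniformly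
  random round. Whether a cell is chosen depends only on its ball of radius \<open>M\<close>, which is a tree, so
  the probabilities satisfy an exact recursion. Its solution is a chosen fraction of order
  \<open>(ln M)\<^bsup>1/(r^2-1)\<^esup> / M\<close>, and \<open>ln M\<close> has order \<open>ln ln N\<close>.\<close>

section \<open>Independence of events with disjoint supports\<close>

text \<open>The size of \<open>M\<close> balances two effects. Chains of up to \<open>2 * M\<close>
  rectangles contribute a factor exp (O (\<open>M\<close> ln \<open>M\<close>)), while an attachment
  that shares more than a corner cell loses a factor \<open>N powr (- 2 / (r + 1))\<close>, which is
  at most exp (- c \<open>M\<close>^2) as soon as exp (\<open>M\<close>^2) \<le> \<open>N\<close>.
  Hence cycles up to twice the dependence radius \<open>M\<close> of the algorithm can be removed at
  negligible cost. With \<open>q = r^2 - 1\<close>, the density bounds the expected number of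
  rectangles through a cell by (\<open>M\<close> / 2)^q; the factor 2^q below the degree bound
  \<open>M ^ q\<close> pays for deleting the cells of too large degree. The recursion is a discrete
  form of y' = exp (- y^q), run for time \<open>M\<close> from y = 1; its solution grows like (ln
  \<open>M\<close>)^(1/q), whereas plain deletion would keep y bounded. Uneven degrees would spoil
  such a recursion; random flags that imitate missing edges make it exact, so that expectations
  suffice and no concentration argument enters.\<close>

definition determined_on :: "'a set \<Rightarrow> (('a \<Rightarrow> 'b) \<Rightarrow> bool) \<Rightarrow> bool" where
  "determined_on N A \<longleftrightarrow> (\<forall>\<omega> \<omega>'. (\<forall>x\<in>N. \<omega> x = \<omega>' x) \<longrightarrow> A \<omega> = A \<omega>')"

lemma determined_onD: "determined_on N A \<Longrightarrow> (\<And>x. x \<in> N \<Longrightarrow> \<omega> x = \<omega>' x) \<Longrightarrow> A \<omega> = A \<omega>'"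
  by (simp add: determined_on_def)

lemma determined_on_Ball:
  "(\<And>i. i \<in> I \<Longrightarrow> determined_on (N i) (A i)) \<Longrightarrow> determined_on (\<Union>i\<in>I. N i) (\<lambda>\<omega>. \<forall>i\<in>I. A i \<omega>)"
  unfolding determined_on_def by (meson UN_I)

lemma determined_on_Not: "determined_on N A \<Longrightarrow> determined_on N (\<lambda>\<omega>. \<not> A \<omega>)"
  unfolding determined_on_def by blast

text \<open>The product measure is split at \<open>N1\<close>: \<open>A\<close> reads only the first
  factor and \<open>B\<close> only the second.\<close>

lemma prob_Pi_pmf_conj:
  assumes fin: "finite V" and N: "N1 \<subseteq> V" "N2 \<subseteq> V" "N1 \<inter> N2 = {}"
    and A: "determined_on N1 A" and B: "determined_on N2 B"
  shows "measure_pmf.prob (Pi_pmf V dflt p) {\<omega>. A \<omega> \<and> B \<omega>} =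
    measure_pmf.prob (Pi_pmf V dflt p) {\<omega>. A \<omega>} * measure_pmf.prob (Pi_pmf V dflt p) {\<omega>. B \<omega>}"
proof -
  define h :: "('a \<Rightarrow> 'b) \<times> ('a \<Rightarrow> 'b) \<Rightarrow> 'a \<Rightarrow> 'b" where "h = (\<lambda>(f, g) x. if x \<in> N1 then f x else g x)"
  define P where "P = Pi_pmf N1 dflt p"
  define Q where "Q = Pi_pmf (V - N1) dflt p"
  have VN: "V = N1 \<union> (V - N1)" using N by blast
  have eq: "Pi_pmf V dflt p = map_pmf h (pair_pmf P Q)"
    unfolding h_def P_def Q_def
    by (subst VN, rule Pi_pmf_union) (use fin N in \<open>auto intro: finite_subset\<close>)
  have hA: "A (h (f, g)) = A f" for f g
    by (rule determined_onD[OF A]) (auto simp: h_def)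
  have hB: "B (h (f, g)) = B g" for f g
    by (rule determined_onD[OF B]) (use N in \<open>auto simp: h_def\<close>)
  have m: "measure_pmf.prob (Pi_pmf V dflt p) {\<omega>. X \<omega> \<and> Y \<omega>} =
      measure_pmf.prob P {f. X' f} * measure_pmf.prob Q {g. Y' g}"
    if "\<And>f g. X (h (f, g)) = X' f" "\<And>f g. Y (h (f, g)) = Y' g" for X Y X' Y'
  proof -
    have "h -` {\<omega>. X \<omega> \<and> Y \<omega>} = {f. X' f} \<times> {g. Y' g}" using that by auto
    then have "measure_pmf.prob (Pi_pmf V dflt p) {\<omega>. X \<omega> \<and> Y \<omega>} =
        measure_pmf.prob (pair_pmf P Q) ({f. X' f} \<times> {g. Y' g})" by (simp add: eq)
    \<comment> \<open>The product rule asks for countable sets, so both events are cut down to the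
      supports, which leaves their probabilities unchanged.\<close>
    also have "\<dots> = measure_pmf.prob (pair_pmf P Q) (({f. X' f} \<inter> set_pmf P) \<times> ({g. Y' g} \<inter> set_pmf Q))"
      by (subst measure_Int_set_pmf[symmetric]) (auto intro!: arg_cong[of _ _ "measure_pmf.prob _"])
    also have "\<dots> = measure_pmf.prob P ({f. X' f} \<inter> set_pmf P) * measure_pmf.prob Q ({g. Y' g} \<inter> set_pmf Q)"
      by (rule measure_pmf_prob_product) (auto intro: countable_subset[OF Int_lower2])
    finally show ?thesis by (simp add: measure_Int_set_pmf)
  qed
  have "measure_pmf.prob (Pi_pmf V dflt p) {\<omega>. A \<omega>} = measure_pmf.prob P {f. A f}"
    using m[of A A "\<lambda>_. True" "\<lambda>_. True"] hA by simp
  moreover have "measure_pmf.prob (Pi_pmf V dflt p) {\<omega>. B \<omega>} = measure_pmf.prob Q {f. B f}"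
    using m[of "\<lambda>_. True" "\<lambda>_. True" B B] hB by simp
  ultimately show ?thesis using m[of A A B B] hA hB by simp
qed

lemma prob_Pi_pmf_Ball:
  assumes fin: "finite V" and "finite I" and N: "\<And>i. i \<in> I \<Longrightarrow> N i \<subseteq> V"
    and disj: "disjoint_family_on N I" and det: "\<And>i. i \<in> I \<Longrightarrow> determined_on (N i) (A i)"
  shows "measure_pmf.prob (Pi_pmf V dflt p) {\<omega>. \<forall>i\<in>I. A i \<omega>} =
    (\<Prod>i\<in>I. measure_pmf.prob (Pi_pmf V dflt p) {\<omega>. A i \<omega>})"
  using assms(2-)
proof (induction I rule: finite_induct)
  case (insert x I)
  have "measure_pmf.prob (Pi_pmf V dflt p) {\<omega>. \<forall>i\<in>insert x I. A i \<omega>} =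
     measure_pmf.prob (Pi_pmf V dflt p) {\<omega>. A x \<omega> \<and> (\<forall>i\<in>I. A i \<omega>)}" by simp
  also have "\<dots> = measure_pmf.prob (Pi_pmf V dflt p) {\<omega>. A x \<omega>} *
     measure_pmf.prob (Pi_pmf V dflt p) {\<omega>. \<forall>i\<in>I. A i \<omega>}"
  proof (rule prob_Pi_pmf_conj[OF fin, where ?N2.0 = "\<Union>i\<in>I. N i"])
    show "determined_on (\<Union>i\<in>I. N i) (\<lambda>\<omega>. \<forall>i\<in>I. A i \<omega>)"
      by (rule determined_on_Ball) (use insert.prems in auto)
    show "N x \<inter> (\<Union>i\<in>I. N i) = {}"
      using insert.prems(2) insert.hyps(2) unfolding disjoint_family_on_def by fastforce
  qed (use insert.prems in auto)
  also have "measure_pmf.prob (Pi_pmf V dflt p) {\<omega>. \<forall>i\<in>I. A i \<omega>} =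
      (\<Prod>i\<in>I. measure_pmf.prob (Pi_pmf V dflt p) {\<omega>. A i \<omega>})"
    by (rule insert.IH) (use insert.prems in \<open>auto simp: disjoint_family_on_def\<close>)
  finally show ?case using insert.hyps by simp
qed simp

text \<open>First moment method for a signed count: the weights \<open>c\<close> may be negative, so
  that a single outcome is at once rich in wanted objects and poor in unwanted ones.\<close>

lemma exists_ge_expectation:
  fixes p :: "'a pmf" and c :: "'i \<Rightarrow> real"
  assumes "finite I"
  shows "\<exists>\<omega>. (\<Sum>i\<in>I. c i * measure_pmf.prob p {\<omega>. A i \<omega>}) \<le> (\<Sum>i\<in>I. c i * of_bool (A i \<omega>))"
proof (rule ccontr)
  assume a: "\<not> ?thesis"
  define X :: "'a \<Rightarrow> real" where "X = (\<lambda>\<omega>. \<Sum>i\<in>I. c i * indicator {\<omega>. A i \<omega>} \<omega>)"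
  define b where "b = (\<Sum>i\<in>I. c i * measure_pmf.prob p {\<omega>. A i \<omega>})"
  have X_less: "X \<omega> < b" for \<omega>
  proof -
    have "X \<omega> = (\<Sum>i\<in>I. c i * of_bool (A i \<omega>))"
      unfolding X_def by (intro sum.cong refl) (simp add: indicator_def)
    then show ?thesis using a unfolding b_def by (metis not_le)
  qed
  have "integrable (measure_pmf p) (indicator {\<omega>. A i \<omega>} :: 'a \<Rightarrow> real)" for i
    by (rule integrable_real_indicator) (simp_all add: measure_pmf.emeasure_finite less_top[symmetric])
  then have int: "integrable (measure_pmf p) (\<lambda>\<omega>. c i * indicator {\<omega>. A i \<omega>} \<omega>)" for i
    by (rule integrable_mult_right)
  have "measure_pmf.expectation p X = b"
    unfolding X_def b_def by (subst Bochner_Integration.integral_sum) (rule int, simp)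
  moreover have "integrable (measure_pmf p) X"
    unfolding X_def by (rule Bochner_Integration.integrable_sum) (rule int)
  then have "measure_pmf.expectation p X < b"
    by (rule measure_pmf.expectation_less) (simp add: X_less)
  ultimately show False by simp
qed

section \<open>Hypergraphs without short cycles\<close>

fun linked :: "'a set list \<Rightarrow> bool" where
  "linked [] = True"
| "linked (f # fs) \<longleftrightarrow> linked fs \<and> (fs \<noteq> [] \<longrightarrow> f \<inter> \<Union>(set fs) \<noteq> {})"

text \<open>Berge girth above \<open>g\<close>: two common points of the head with the rest of the
  chain would close a cycle. This form by chains is the one that the random construction
  controls.\<close>

definition acyclic_upto :: "nat \<Rightarrow> 'a set set \<Rightarrow> bool" where
  "acyclic_upto g H \<longleftrightarrow> (\<forall>f fs. linked (f # fs) \<and> distinct (f # fs) \<and> set (f # fs) \<subseteq> H \<and>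
     length (f # fs) \<le> g \<longrightarrow> (\<forall>x\<in>f \<inter> \<Union>(set fs). \<forall>y\<in>f \<inter> \<Union>(set fs). x = y))"

text \<open>Here \<open>e\<close> is the edge through which \<open>u\<close> was entered, so a walk
  never leaves through the edge just used; \<open>e = {}\<close> forbids nothing, as an edge through
  \<open>u\<close> is nonempty.\<close>

fun walk :: "'a set set \<Rightarrow> 'a \<Rightarrow> 'a set \<Rightarrow> ('a set \<times> 'a) list \<Rightarrow> bool" where
  "walk H u e [] = True"
| "walk H u e ((f, w) # xs) \<longleftrightarrow> f \<in> H \<and> u \<in> f \<and> w \<in> f \<and> w \<noteq> u \<and> f \<noteq> e \<and> walk H w f xs"

fun walk_end :: "'a \<Rightarrow> ('a set \<times> 'a) list \<Rightarrow> 'a" where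
  "walk_end u [] = u"
| "walk_end u ((f, w) # xs) = walk_end w xs"

lemma walk_end_in: "walk H u e xs \<Longrightarrow> xs \<noteq> [] \<Longrightarrow> walk_end u xs \<in> \<Union>(set (map fst xs))"
proof (induction xs arbitrary: u e)
  case (Cons a xs)
  obtain f w where [simp]: "a = (f, w)" by force
  show ?case using Cons by (cases xs) auto
qed simp

text \<open>Induction from the far end: the new edge meets the linked chain of the remaining edges
  in \<open>w\<close>, hence by acyclicity nowhere else, so \<open>u\<close> is off that chain. The
  clause on \<open>tl xs\<close> is the strengthening that carries the induction.\<close>

lemma walk_edges:
  assumes "acyclic_upto g H" "walk H u e xs" "xs \<noteq> []" "length xs \<le> g"
  shows "distinct (map fst xs) \<and> linked (map fst xs) \<and> set (map fst xs) \<subseteq> H \<and>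
    u \<notin> \<Union>(set (map fst (tl xs))) \<and> walk_end u xs \<noteq> u"
  using assms(2-)
proof (induction xs arbitrary: u e)
  case (Cons a ys)
  obtain f w where a: "a = (f, w)" by force
  show ?case
  proof (cases "ys = []")
    case True
    then show ?thesis using Cons.prems a by auto
  next
    case False
    from Cons.prems a have fw: "f \<in> H" "u \<in> f" "w \<in> f" "w \<noteq> u" "walk H w f ys" by auto
    have IH: "distinct (map fst ys)" "linked (map fst ys)" "set (map fst ys) \<subseteq> H"
      "w \<notin> \<Union>(set (map fst (tl ys)))"
      using Cons.IH[OF fw(5) False] Cons.prems by auto
    obtain f2 w2 zs where ys: "ys = (f2, w2) # zs" using False by (cases ys) auto
    have f2: "w \<in> f2" "f2 \<noteq> f" using fw(5) ys by auto
    \<comment> \<open>The first remaining edge differs from \<open>f\<close> since the walk does not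
      turn back, the later ones since they miss \<open>w\<close>.\<close>
    have nin: "f \<notin> set (map fst ys)" using f2 IH(4) ys fw(3) by fastforce
    have dist: "distinct (map fst (a # ys))" using nin IH a by simp
    have lin: "linked (map fst (a # ys))" using IH f2 fw a ys by auto
    have "\<forall>x\<in>f \<inter> \<Union>(set (map fst ys)). \<forall>y\<in>f \<inter> \<Union>(set (map fst ys)). x = y"
      using assms(1)[unfolded acyclic_upto_def, rule_format, of f "map fst ys"] dist lin IH fw a Cons.prems
      by auto
    moreover have "w \<in> f \<inter> \<Union>(set (map fst ys))" using f2 fw ys by auto
    ultimately have u: "u \<notin> \<Union>(set (map fst ys))" using fw by blast
    have "walk_end w ys \<in> \<Union>(set (map fst ys))" using walk_end_in[OF fw(5) False] .
    then have "walk_end u (a # ys) \<noteq> u" using u a by auto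
    then show ?thesis using dist lin u IH fw a by auto
  qed
qed simp

text \<open>Two walks that leave \<open>u\<close> differently and meet again would form a closed
  walk. The first walk is absorbed into the second step by step until only a closed walk is left,
  which \<open>walk_edges\<close> forbids.\<close>

lemma walk_ends_differ:
  assumes ac: "acyclic_upto g H"
  shows "walk H u e xs \<Longrightarrow> walk H u e' ys \<Longrightarrow> xs \<noteq> [] \<or> ys \<noteq> [] \<Longrightarrow>
    xs = [] \<or> ys = [] \<or> hd xs \<noteq> hd ys \<Longrightarrow> length xs + length ys \<le> g \<Longrightarrow>
    walk_end u xs \<noteq> walk_end u ys"
proof (induction xs arbitrary: u e e' ys)
  case Nil
  then show ?case using walk_edges[OF ac, of u e' ys] by auto
next
  case (Cons a xs)
  obtain f w where a: "a = (f, w)" by force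
  show ?case
  proof (cases ys)
    case Nil
    then show ?thesis using walk_edges[OF ac, of u e "a # xs"] Cons.prems by auto
  next
    case (Cons b ys')
    obtain f' w' where b: "b = (f', w')" by force
    note pr = Cons.prems[unfolded a Cons b]
    \<comment> \<open>Moves the base point from \<open>u\<close> to \<open>w\<close>: the second
      walk is entered by going back through \<open>f\<close> to \<open>u\<close> or, if it starts
      with \<open>f\<close> itself, by crossing \<open>f\<close> from \<open>w\<close> directly to
      \<open>w'\<close>. The total length does not grow.\<close>
    define zs where "zs = (if f = f' then ys else (f, u) # ys)"
    have z: "walk H w {} zs" "hd zs = (f, if f = f' then w' else u)" "zs \<noteq> []" "walk_end w zs = walk_end u ys"
      using pr Cons b unfolding zs_def by auto
    have "walk H w f xs" using pr by auto
    moreover have "xs = [] \<or> zs = [] \<or> hd xs \<noteq> hd zs" using pr z by (cases xs) auto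
    moreover have "length xs + length zs \<le> g" using pr Cons by (auto simp: zs_def)
    ultimately have "walk_end w xs \<noteq> walk_end w zs" using Cons.IH z by blast
    then show ?thesis using z a by simp
  qed
qed

text \<open>The branch hanging below \<open>e\<close> at \<open>u\<close>, cut off at depth
  \<open>d\<close>.\<close>

definition reach :: "'a set set \<Rightarrow> nat \<Rightarrow> 'a \<Rightarrow> 'a set \<Rightarrow> 'a set" where
  "reach H d u e = {walk_end u xs | xs. walk H u e xs \<and> length xs \<le> d}"

lemma reach_self: "u \<in> reach H d u e"
  unfolding reach_def by (rule CollectI, rule exI[of _ "[]"]) simp

lemma reach_mono: "d \<le> d' \<Longrightarrow> reach H d u e \<subseteq> reach H d' u e"
  unfolding reach_def by fastforce

lemma reach_step:
  "f \<in> H \<Longrightarrow> u \<in> f \<Longrightarrow> w \<in> f \<Longrightarrow> w \<noteq> u \<Longrightarrow> f \<noteq> e \<Longrightarrow> reach H d w f \<subseteq> reach H (Suc d) u e"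
proof
  fix z assume a: "f \<in> H" "u \<in> f" "w \<in> f" "w \<noteq> u" "f \<noteq> e" "z \<in> reach H d w f"
  then obtain xs where "walk H w f xs" "length xs \<le> d" "walk_end w xs = z" unfolding reach_def by auto
  then show "z \<in> reach H (Suc d) u e" using a unfolding reach_def
    by (intro CollectI exI[of _ "(f, w) # xs"]) auto
qed

lemma reach_subset:
  assumes "\<Union>H \<subseteq> V" "u \<in> V" shows "reach H d u e \<subseteq> V"
proof
  fix z assume "z \<in> reach H d u e"
  then obtain xs where xs: "walk H u e xs" "walk_end u xs = z" unfolding reach_def by auto
  then show "z \<in> V" using assms(2)
  proof (induction xs arbitrary: u e)
    case (Cons a xs) then show ?case using assms(1) by (cases a) auto
  qed simp
qed

lemma reach_notin:
  assumes "acyclic_upto g H" "Suc d \<le> g" "f \<in> H" "u \<in> f" "w \<in> f" "w \<noteq> u"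
  shows "u \<notin> reach H d w f"
proof
  assume "u \<in> reach H d w f"
  then obtain xs where "walk H w f xs" "length xs \<le> d" "walk_end w xs = u" unfolding reach_def by auto
  then show False
    using walk_edges[OF assms(1), of u "{}" "(f, w) # xs"] assms by auto
qed

text \<open>Prefixing the steps out of \<open>u\<close> turns a common vertex into two walks from
  \<open>u\<close> with different first steps and the same end. Their total length
  \<open>2 * Suc d\<close> is why cycles up to \<open>2 * M\<close> have to be excluded.\<close>

lemma reach_disjoint:
  assumes "acyclic_upto g H" "2 * Suc d \<le> g" "f \<in> H" "u \<in> f" "w \<in> f" "w \<noteq> u"
    and "f' \<in> H" "u \<in> f'" "w' \<in> f'" "w' \<noteq> u" "(f, w) \<noteq> (f', w')"
  shows "reach H d w f \<inter> reach H d w' f' = {}"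
proof (rule ccontr)
  assume "reach H d w f \<inter> reach H d w' f' \<noteq> {}"
  then obtain xs ys where "walk H w f xs" "length xs \<le> d" "walk H w' f' ys" "length ys \<le> d"
     "walk_end w xs = walk_end w' ys" unfolding reach_def by auto
  then show False
    using walk_ends_differ[OF assms(1), of u "{}" "(f, w) # xs" "{}" "(f', w') # ys"] assms by auto
qed

section \<open>The local random greedy algorithm\<close>

text \<open>On a tree, \<open>pass_prob q M i\<close> is the probability that a vertex with label \<open>i\<close> is chosen, given that the
  edge towards the root is ignored, and \<open>block_prob q M i\<close> is the probability that a child has label \<open>i\<close> or
  is chosen with a smaller label.\<close>

fun pass_prob :: "nat \<Rightarrow> nat \<Rightarrow> nat \<Rightarrow> real" where
  "pass_prob q M i = (1 - ((1 + (\<Sum>j\<in>{..<i}. pass_prob q M j)) / real M) ^ q) ^ (M ^ q)"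

declare pass_prob.simps [simp del]

definition block_prob :: "nat \<Rightarrow> nat \<Rightarrow> nat \<Rightarrow> real" where
  "block_prob q M i = (1 + (\<Sum>j<i. pass_prob q M j)) / real M"

lemma pass_prob_eq: "pass_prob q M i = (1 - block_prob q M i ^ q) ^ (M ^ q)"
  by (subst pass_prob.simps) (simp add: block_prob_def)

text \<open>At most \<open>i\<close> from the summands and 1 from the leading term give
  \<open>i + 1 \<le> M\<close>, the denominator.\<close>

lemma pass_block_prob_bounds: "i < M \<Longrightarrow> 0 \<le> pass_prob q M i \<and> pass_prob q M i \<le> 1 \<and> 0 \<le> block_prob q M i \<and> block_prob q M i \<le> 1"
proof (induction i rule: less_induct)
  case (less i)
  have s: "0 \<le> (\<Sum>j<i. pass_prob q M j)" "(\<Sum>j<i. pass_prob q M j) \<le> (\<Sum>j<i. 1)"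
    using less by (force intro!: sum_nonneg, intro sum_mono) (use less in force)
  have b: "0 \<le> block_prob q M i" "block_prob q M i \<le> 1"
    using s less.prems by (auto simp: block_prob_def field_simps)
  then have "0 \<le> block_prob q M i ^ q" "block_prob q M i ^ q \<le> 1" by (auto simp: power_le_one)
  then have "0 \<le> pass_prob q M i" "pass_prob q M i \<le> 1" unfolding pass_prob_eq by (auto intro: power_le_one)
  with b show ?case by simp
qed

text \<open>A vertex of degree \<open>d\<close> carries a uniform label and a flag. The flag simulates
  \<open>M ^ q + 1 - d\<close> missing edges, so that all vertices obey the same recursion although the hypergraph
  need not be regular.\<close>

definition label_pmf :: "nat \<Rightarrow> nat \<Rightarrow> nat \<Rightarrow> (nat \<times> bool) pmf" where
  "label_pmf q M d = bind_pmf (pmf_of_set {..<M})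
     (\<lambda>i. map_pmf (Pair i) (bernoulli_pmf ((1 - block_prob q M i ^ q) ^ (M ^ q + 1 - d))))"

lemma label_pmf_fst: "map_pmf fst (label_pmf q M d) = pmf_of_set {..<M}"
  unfolding label_pmf_def map_bind_pmf pmf.map_comp
  by (simp add: o_def map_pmf_const bind_return_pmf')

lemma prob_label_fst:
  assumes "i < M"
  shows "measure_pmf.prob (label_pmf q M d) {x. fst x = i} = 1 / M"
proof -
  have "measure_pmf.prob (label_pmf q M d) {x. fst x = i} = measure_pmf.prob (map_pmf fst (label_pmf q M d)) {i}"
    by (simp add: vimage_def)
  also have "\<dots> = 1 / M" unfolding label_pmf_fst using assms
    by (subst measure_pmf_of_set) auto
  finally show ?thesis .
qed

lemma prob_label_True:
  assumes "i < M"
  shows "measure_pmf.prob (label_pmf q M d) {x. x = (i, True)} = (1 - block_prob q M i ^ q) ^ (M ^ q + 1 - d) / M"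
proof -
  have b: "0 \<le> (1 - block_prob q M i ^ q) ^ (M ^ q + 1 - d)" "(1 - block_prob q M i ^ q) ^ (M ^ q + 1 - d) \<le> 1"
    using pass_block_prob_bounds[OF assms, of q] by (auto intro!: power_le_one zero_le_power)
  have e: "pmf (map_pmf (Pair j) B) (i, True) = (if j = i then pmf B True else 0)" for j and B :: "bool pmf"
  proof (cases "j = i")
    case True then show ?thesis by (simp add: pmf_map_inj' inj_def)
  next
    case False then show ?thesis by (auto simp: pmf_eq_0_set_pmf)
  qed
  have "measure_pmf.prob (label_pmf q M d) {x. x = (i, True)} = pmf (label_pmf q M d) (i, True)"
    by (simp add: measure_pmf_single)
  also have "\<dots> = (1 - block_prob q M i ^ q) ^ (M ^ q + 1 - d) / M"
    unfolding label_pmf_def using assms b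
    by (subst pmf_bind_pmf_of_set) (auto simp: e if_distrib sum.delta' cong: if_cong)
  finally show ?thesis .
qed

text \<open>\<open>chosen H i u e\<close>: the vertex \<open>u\<close> gets label \<open>i\<close> and is chosen when the edge \<open>e\<close> is ignored
  (\<open>e = {}\<close> ignores nothing). Vertices with equal labels block each other whether or not they are chosen;
  this keeps the chosen set independent without any tie-breaking.\<close>

function chosen :: "'a set set \<Rightarrow> nat \<Rightarrow> 'a \<Rightarrow> 'a set \<Rightarrow> ('a \<Rightarrow> nat \<times> bool) \<Rightarrow> bool" where
  "chosen H i u e \<omega> \<longleftrightarrow> \<omega> u = (i, True) \<and>
     (\<forall>f\<in>H. u \<in> f \<longrightarrow> f \<noteq> e \<longrightarrow> (\<exists>w\<in>f - {u}. fst (\<omega> w) \<noteq> i \<and> (\<forall>j\<in>{..<i}. \<not> chosen H j w f \<omega>)))"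
  by pat_completeness auto
termination by (relation "Wellfounded.measure (\<lambda>(H, i, u, e, \<omega>). i)") auto

declare chosen.simps [simp del]

text \<open>What an edge \<open>f\<close> at a vertex of label \<open>i\<close> needs from
  \<open>w\<close>. The choice of \<open>w\<close> ignores \<open>f\<close>, so it depends only on
  the branch beyond \<open>w\<close>.\<close>

definition blocks :: "'a set set \<Rightarrow> nat \<Rightarrow> 'a \<Rightarrow> 'a set \<Rightarrow> ('a \<Rightarrow> nat \<times> bool) \<Rightarrow> bool" where
  "blocks H i w f \<omega> \<longleftrightarrow> fst (\<omega> w) = i \<or> (\<exists>j<i. chosen H j w f \<omega>)"

lemma chosen_iff:
  "chosen H i u e \<omega> \<longleftrightarrow> \<omega> u = (i, True) \<and>
     (\<forall>f\<in>{f\<in>H. u \<in> f \<and> f \<noteq> e}. \<not> (\<forall>w\<in>f - {u}. blocks H i w f \<omega>))"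
proof -
  have "(\<exists>w\<in>f - {u}. fst (\<omega> w) \<noteq> i \<and> (\<forall>j\<in>{..<i}. \<not> chosen H j w f \<omega>)) \<longleftrightarrow>
      \<not> (\<forall>w\<in>f - {u}. blocks H i w f \<omega>)" for f
    by (simp add: blocks_def Ball_def Bex_def)
  then have "chosen H i u e \<omega> \<longleftrightarrow> \<omega> u = (i, True) \<and>
      (\<forall>f\<in>H. u \<in> f \<longrightarrow> f \<noteq> e \<longrightarrow> \<not> (\<forall>w\<in>f - {u}. blocks H i w f \<omega>))"
    by (subst chosen.simps) (simp only: )
  then show ?thesis by (simp add: Ball_def imp_conjL)
qed

lemma chosen_label: "chosen H i u e \<omega> \<Longrightarrow> \<omega> u = (i, True)"
  by (simp add: chosen_iff)

lemma chosen_mono: "chosen H i u {} \<omega> \<Longrightarrow> chosen H i u e \<omega>"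
proof -
  assume c: "chosen H i u {} \<omega>"
  have "{f \<in> H. u \<in> f \<and> f \<noteq> e} \<subseteq> {f \<in> H. u \<in> f \<and> f \<noteq> {}}" by auto
  with c show ?thesis unfolding chosen_iff[of H i u] by (meson subsetD)
qed

text \<open>Labels strictly decrease along the recursion, so the label itself bounds the distance at
  which information is collected.\<close>

lemma determined_chosen: "determined_on (reach H (Suc i) u e) (chosen H i u e)"
proof (induction i arbitrary: u e rule: less_induct)
  case (less i)
  show ?case unfolding determined_on_def
  proof (intro allI impI)
    fix \<omega> \<omega>' :: "'a \<Rightarrow> nat \<times> bool"
    assume eq: "\<forall>x\<in>reach H (Suc i) u e. \<omega> x = \<omega>' x"
    have "blocks H i w f \<omega> = blocks H i w f \<omega>'" if f: "f \<in> H" "u \<in> f" "f \<noteq> e" "w \<in> f - {u}" for f w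
    proof -
      have sub: "reach H i w f \<subseteq> reach H (Suc i) u e" using f by (intro reach_step) auto
      have "chosen H j w f \<omega> = chosen H j w f \<omega>'" if "j < i" for j
        by (rule determined_onD[OF less[OF that]])
          (use eq sub reach_mono[of "Suc j" i H w f] that in auto)
      moreover have "\<omega> w = \<omega>' w" using eq sub reach_self[of w H i f] by blast
      ultimately show ?thesis by (auto simp: blocks_def)
    qed
    moreover have "\<omega> u = \<omega>' u" using eq reach_self[of u H "Suc i" e] by blast
    ultimately show "chosen H i u e \<omega> = chosen H i u e \<omega>'" by (simp add: chosen_iff)
  qed
qed

lemma determined_blocks: "determined_on (reach H i w f) (blocks H i w f)"
  unfolding determined_on_def
proof (intro allI impI)
  fix \<omega> \<omega>' :: "'a \<Rightarrow> nat \<times> bool"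
  assume eq: "\<forall>x\<in>reach H i w f. \<omega> x = \<omega>' x"
  have "chosen H j w f \<omega> = chosen H j w f \<omega>'" if "j < i" for j
    by (rule determined_onD[OF determined_chosen]) (use eq reach_mono[of "Suc j" i H w f] that in auto)
  moreover have "\<omega> w = \<omega>' w" using eq reach_self[of w H i f] by blast
  ultimately show "blocks H i w f \<omega> = blocks H i w f \<omega>'" by (auto simp: blocks_def)
qed

definition chosen_set :: "'a set \<Rightarrow> 'a set set \<Rightarrow> nat \<Rightarrow> ('a \<Rightarrow> nat \<times> bool) \<Rightarrow> 'a set" where
  "chosen_set V H M \<omega> = {v \<in> V. \<exists>i<M. chosen H i v {} \<omega>}"

text \<open>A vertex \<open>v\<close> of largest label in \<open>e\<close> would need some
  \<open>w\<close> in \<open>e\<close> that does not block it. Then \<open>w\<close> has a smaller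
  label, and being chosen outright it is also chosen when \<open>e\<close> is ignored, so it does
  block.\<close>

lemma chosen_set_independent:
  assumes "e \<in> H" "finite e" "e \<noteq> {}"
  shows "\<not> e \<subseteq> chosen_set V H M \<omega>"
proof
  assume sub: "e \<subseteq> chosen_set V H M \<omega>"
  have c: "chosen H (fst (\<omega> w)) w {} \<omega>" if "w \<in> e" for w
    using sub that chosen_label by (fastforce simp: chosen_set_def)
  define m where "m = Max ((\<lambda>w. fst (\<omega> w)) ` e)"
  have "m \<in> (\<lambda>w. fst (\<omega> w)) ` e" unfolding m_def using assms by (intro Max_in) auto
  then obtain v where v: "v \<in> e" "m = fst (\<omega> v)" by auto
  have max: "fst (\<omega> w) \<le> m" if "w \<in> e" for w unfolding m_def using that assms by auto
  from c[OF v(1)] v assms obtain w where w: "w \<in> e - {v}" "\<not> blocks H m w e \<omega>"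
    unfolding chosen_iff by blast
  then have "fst (\<omega> w) < m" using max[of w] by (auto simp: blocks_def)
  moreover have "chosen H (fst (\<omega> w)) w e \<omega>" using w(1) by (simp add: chosen_mono[OF c])
  ultimately show False using w(2) by (auto simp: blocks_def)
qed

section \<open>Exact selection probabilities on locally tree-like hypergraphs\<close>

locale treelike_hypergraph =
  fixes V :: "'a set" and H :: "'a set set" and q M :: nat
  assumes finV: "finite V" and HV: "\<Union>H \<subseteq> V" and card_edge: "f \<in> H \<Longrightarrow> card f = Suc q"
    and M_pos: "M > 0" and degree: "v \<in> V \<Longrightarrow> card {f\<in>H. v \<in> f} \<le> M ^ q"
    and acyclic: "acyclic_upto (2 * M) H"
begin

definition labels :: "('a \<Rightarrow> nat \<times> bool) pmf" where
  "labels = Pi_pmf V (0, False) (\<lambda>v. label_pmf q M (card {f\<in>H. v \<in> f}))"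

abbreviation "prb X \<equiv> measure_pmf.prob labels {\<omega>. X \<omega>}"

lemma prb_component:
  assumes "u \<in> V"
  shows "prb (\<lambda>\<omega>. P (\<omega> u)) = measure_pmf.prob (label_pmf q M (card {f\<in>H. u \<in> f})) {x. P x}"
proof -
  have "map_pmf (\<lambda>\<omega>. \<omega> u) labels = label_pmf q M (card {f\<in>H. u \<in> f})"
    unfolding labels_def using assms finV by (subst Pi_pmf_component) auto
  then have "measure_pmf.prob (label_pmf q M (card {f\<in>H. u \<in> f})) {x. P x} =
     measure_pmf.prob (map_pmf (\<lambda>\<omega>. \<omega> u) labels) {x. P x}" by simp
  then show ?thesis by (simp add: vimage_def)
qed

lemma finH: "finite H"
  by (rule finite_subset[of _ "Pow V"]) (use finV HV in auto)

lemma fin_edge: "f \<in> H \<Longrightarrow> finite f" using finV HV by (blast intro: finite_subset[of f V])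

text \<open>The branches below the edges at \<open>u\<close> are disjoint, so the vetoes of these
  edges are independent, each of probability \<open>block_prob q M i ^ q\<close>; the flag supplies
  the remaining factors. The induction hypothesis is an assumption because the same computation
  serves inner vertices and the root.\<close>

lemma prb_chosen_aux:
  assumes i: "i < M" and u: "u \<in> V"
    and IH: "\<And>j w f. j < i \<Longrightarrow> f \<in> H \<Longrightarrow> w \<in> f \<Longrightarrow> prb (chosen H j w f) = pass_prob q M j / M"
  shows "prb (chosen H i u e) =
    (1 - block_prob q M i ^ q) ^ (M ^ q + 1 - card {f\<in>H. u \<in> f} + card {f\<in>H. u \<in> f \<and> f \<noteq> e}) / M"
proof -
  define F where "F = {f\<in>H. u \<in> f \<and> f \<noteq> e}"
  define C where "C = (\<lambda>f \<omega>. \<not> (\<forall>w\<in>f - {u}. blocks H i w f \<omega>))"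
  define N where "N = (\<lambda>f. \<Union>w\<in>f - {u}. reach H i w f)"
  have F: "f \<in> H" "u \<in> f" "finite f" if "f \<in> F" for f using that fin_edge by (auto simp: F_def)
  have inV: "w \<in> V" if "f \<in> H" "w \<in> f" for f w using that HV by blast
  have reachV: "reach H i w f \<subseteq> V" if "f \<in> F" "w \<in> f" for f w
    using reach_subset[OF HV inV[OF F(1)[OF that(1)] that(2)]] .
  have NV: "N f \<subseteq> V" if "f \<in> F" for f unfolding N_def using reachV that by blast
  have g: "Suc i \<le> 2 * M" "2 * Suc i \<le> 2 * M" using i by auto
  have detC: "determined_on (N f) (C f)" for f
    unfolding N_def C_def by (intro determined_on_Not determined_on_Ball determined_blocks)
  have prb_blocks: "prb (blocks H i w f) = block_prob q M i" if f: "f \<in> F" "w \<in> f" for f w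
  proof -
    have wV: "w \<in> V" using inV F f by blast
    have eq: "{\<omega>. blocks H i w f \<omega>} = {\<omega>. fst (\<omega> w) = i} \<union> (\<Union>j\<in>{..<i}. {\<omega>. chosen H j w f \<omega>})"
      by (auto simp: blocks_def)
    \<comment> \<open>A vertex carries only one label, so the events are disjoint and probabilities
      add up exactly.\<close>
    have "prb (blocks H i w f) = prb (\<lambda>\<omega>. fst (\<omega> w) = i) +
        measure_pmf.prob labels (\<Union>j\<in>{..<i}. {\<omega>. chosen H j w f \<omega>})"
      unfolding eq by (rule measure_pmf.finite_measure_Union) (auto dest: chosen_label)
    also have "measure_pmf.prob labels (\<Union>j\<in>{..<i}. {\<omega>. chosen H j w f \<omega>}) =
        (\<Sum>j\<in>{..<i}. prb (chosen H j w f))"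
      by (rule measure_pmf.finite_measure_finite_Union)
        (auto simp: disjoint_family_on_def dest!: chosen_label)
    also have "\<dots> = (\<Sum>j\<in>{..<i}. pass_prob q M j / M)"
      by (intro sum.cong refl IH) (use f F in auto)
    also have "prb (\<lambda>\<omega>. fst (\<omega> w) = i) = 1 / M"
      using prb_component[OF wV, of "\<lambda>x. fst x = i"] prob_label_fst[OF i] by simp
    finally show ?thesis by (simp add: block_prob_def add_divide_distrib sum_divide_distrib)
  qed
  have prb_C: "prb (C f) = 1 - block_prob q M i ^ q" if f: "f \<in> F" for f
  proof -
    have "prb (\<lambda>\<omega>. \<forall>w\<in>f - {u}. blocks H i w f \<omega>) = (\<Prod>w\<in>f - {u}. prb (blocks H i w f))"
      unfolding labels_def
    proof (rule prob_Pi_pmf_Ball[OF finV, where N = "\<lambda>w. reach H i w f"])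
      show "disjoint_family_on (\<lambda>w. reach H i w f) (f - {u})"
        unfolding disjoint_family_on_def using reach_disjoint[OF acyclic g(2)] F[OF f] by auto
    qed (use F[OF f] reachV[OF f] determined_blocks in auto)
    also have "\<dots> = (\<Prod>w\<in>f - {u}. block_prob q M i)" using prb_blocks f by (intro prod.cong) auto
    also have "\<dots> = block_prob q M i ^ q" using F[OF f] card_edge[of f] by simp
    finally have eq: "prb (\<lambda>\<omega>. \<forall>w\<in>f - {u}. blocks H i w f \<omega>) = block_prob q M i ^ q" .
    have "measure_pmf.prob labels (space (measure_pmf labels) - {\<omega>. \<forall>w\<in>f - {u}. blocks H i w f \<omega>}) =
        1 - block_prob q M i ^ q"
      by (subst eq[symmetric], rule measure_pmf.prob_compl) simp
    moreover have "space (measure_pmf labels) - {\<omega>. \<forall>w\<in>f - {u}. blocks H i w f \<omega>} = {\<omega>. C f \<omega>}" by (auto simp: C_def)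
    ultimately show ?thesis by simp
  qed
  have disjN: "disjoint_family_on N F"
    unfolding disjoint_family_on_def
  proof (intro ballI impI)
    fix f f' assume f: "f \<in> F" "f' \<in> F" "f \<noteq> f'"
    have "reach H i w f \<inter> reach H i w' f' = {}" if "w \<in> f - {u}" "w' \<in> f' - {u}" for w w'
      using reach_disjoint[OF acyclic g(2), of f u w f' w'] f that F[OF f(1)] F[OF f(2)] by simp
    then show "N f \<inter> N f' = {}" unfolding N_def by blast
  qed
  have "prb (chosen H i u e) = prb (\<lambda>\<omega>. \<omega> u = (i, True) \<and> (\<forall>f\<in>F. C f \<omega>))"
    by (simp add: chosen_iff F_def C_def)
  also have "\<dots> = prb (\<lambda>\<omega>. \<omega> u = (i, True)) * prb (\<lambda>\<omega>. \<forall>f\<in>F. C f \<omega>)"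
    unfolding labels_def
  proof (rule prob_Pi_pmf_conj[OF finV, where ?N1.0 = "{u}" and ?N2.0 = "\<Union>f\<in>F. N f"])
    show "determined_on (\<Union>f\<in>F. N f) (\<lambda>\<omega>. \<forall>f\<in>F. C f \<omega>)" by (intro determined_on_Ball detC)
    show "{u} \<inter> (\<Union>f\<in>F. N f) = {}" using reach_notin[OF acyclic g(1)] F by (auto simp: N_def)
  qed (use u NV in \<open>auto simp: determined_on_def\<close>)
  also have "prb (\<lambda>\<omega>. \<forall>f\<in>F. C f \<omega>) = (\<Prod>f\<in>F. prb (C f))"
    unfolding labels_def
    by (rule prob_Pi_pmf_Ball[OF finV _ _ disjN]) (use NV detC finH in \<open>auto simp: F_def\<close>)
  also have "\<dots> = (1 - block_prob q M i ^ q) ^ card F" using prb_C by simp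
  also have "prb (\<lambda>\<omega>. \<omega> u = (i, True)) = (1 - block_prob q M i ^ q) ^ (M ^ q + 1 - card {f\<in>H. u \<in> f}) / M"
    using prb_component[OF u, of "\<lambda>x. x = (i, True)"] prob_label_True[OF i] by simp
  finally show ?thesis by (simp add: power_add F_def)
qed

text \<open>A vertex of degree \<open>n\<close> entered through \<open>e\<close> has
  \<open>n - 1\<close> further edges, and the flag contributes \<open>M ^ q + 1 - n\<close> factors;
  the total \<open>M ^ q\<close> no longer depends on the vertex.\<close>

lemma prb_chosen:
  assumes "i < M" "e \<in> H" "u \<in> e"
  shows "prb (chosen H i u e) = pass_prob q M i / M"
  using assms
proof (induction i arbitrary: u e rule: less_induct)
  case (less i)
  have uV: "u \<in> V" using less.prems HV by blast
  define n where "n = card {f\<in>H. u \<in> f}"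
  have "{f\<in>H. u \<in> f \<and> f \<noteq> e} = {f\<in>H. u \<in> f} - {e}" by auto
  then have c: "card {f\<in>H. u \<in> f \<and> f \<noteq> e} = n - 1" using less.prems finH unfolding n_def by simp
  have "e \<in> {f\<in>H. u \<in> f}" using less.prems by simp
  then have "n > 0" using finH unfolding n_def by (auto simp: card_gt_0_iff)
  moreover have "n \<le> M ^ q" using degree[OF uV] n_def by simp
  ultimately have "M ^ q + 1 - n + (n - 1) = M ^ q" by simp
  then show ?case
    using prb_chosen_aux[OF less.prems(1) uV, of e] less.IH less.prems(1) c
    unfolding n_def[symmetric] by (simp add: pass_prob_eq)
qed

text \<open>At the root no edge is ignored, which gives one factor more than inside the
  tree.\<close>

lemma prb_chosen_root:
  assumes "i < M" "u \<in> V"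
  shows "prb (chosen H i u {}) = pass_prob q M i * (1 - block_prob q M i ^ q) / M"
proof -
  have "{f\<in>H. u \<in> f \<and> f \<noteq> {}} = {f\<in>H. u \<in> f}" by auto
  moreover have "prb (chosen H i u {}) =
    (1 - block_prob q M i ^ q) ^ (M ^ q + 1 - card {f\<in>H. u \<in> f} + card {f\<in>H. u \<in> f \<and> f \<noteq> {}}) / M"
    by (rule prb_chosen_aux[OF assms], rule prb_chosen) (use assms in auto)
  ultimately show ?thesis using degree[OF assms(2)] by (simp add: pass_prob_eq)
qed

lemma exists_independent:
  "\<exists>J\<subseteq>V. (\<forall>e\<in>H. \<not> e \<subseteq> J) \<and>
     real (card V) / M * (\<Sum>i<M. pass_prob q M i * (1 - block_prob q M i ^ q)) \<le> card J"
proof -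
  obtain \<omega> where \<omega>: "(\<Sum>x\<in>V \<times> {..<M}. 1 * prb (chosen H (snd x) (fst x) {})) \<le>
      (\<Sum>x\<in>V \<times> {..<M}. 1 * of_bool (chosen H (snd x) (fst x) {} \<omega>))"
    using exists_ge_expectation[of "V \<times> {..<M}" "\<lambda>_. 1" labels "\<lambda>x. chosen H (snd x) (fst x) {}",
      OF finite_cartesian_product[OF finV finite_lessThan]] by blast
  have "(\<Sum>x\<in>V \<times> {..<M}. of_bool (chosen H (snd x) (fst x) {} \<omega>)) =
      (\<Sum>v\<in>V. \<Sum>i<M. of_bool (chosen H i v {} \<omega>) :: real)"
    unfolding sum.cartesian_product by (intro sum.cong refl) (simp add: case_prod_unfold)
  also have "\<dots> \<le> (\<Sum>v\<in>V. of_bool (v \<in> chosen_set V H M \<omega>))"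
  proof (rule sum_mono)
    fix v assume v: "v \<in> V"
    \<comment> \<open>Only the label carried by \<open>v\<close> can succeed, so summing over the
      rounds counts each vertex at most once.\<close>
    have eq: "of_bool (chosen H i v {} \<omega>) =
       (if i = fst (\<omega> v) then of_bool (chosen H i v {} \<omega>) else 0 :: real)" for i
      using chosen_label[of H i v "{}" \<omega>] by auto
    have "(\<Sum>i<M. of_bool (chosen H i v {} \<omega>) :: real) =
        (\<Sum>i<M. if i = fst (\<omega> v) then of_bool (chosen H i v {} \<omega>) else 0)"
      by (intro sum.cong refl eq)
    also have "\<dots> = (if fst (\<omega> v) < M then of_bool (chosen H (fst (\<omega> v)) v {} \<omega>) else 0)"
      by (subst sum.delta) auto
    also have "\<dots> \<le> of_bool (v \<in> chosen_set V H M \<omega>)" using v by (auto simp: chosen_set_def)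
    finally show "(\<Sum>i<M. of_bool (chosen H i v {} \<omega>) :: real) \<le> of_bool (v \<in> chosen_set V H M \<omega>)" .
  qed
  also have "\<dots> = card (chosen_set V H M \<omega>)"
    using finV by (simp add: chosen_set_def Int_def of_bool_def sum.If_cases)
  finally have 1: "(\<Sum>x\<in>V \<times> {..<M}. of_bool (chosen H (snd x) (fst x) {} \<omega>)) \<le> real (card (chosen_set V H M \<omega>))" .
  have "(\<Sum>x\<in>V \<times> {..<M}. prb (chosen H (snd x) (fst x) {})) =
     (\<Sum>v\<in>V. \<Sum>i<M. prb (chosen H i v {}))"
    unfolding sum.cartesian_product by (intro sum.cong refl) (simp add: case_prod_unfold)
  also have "\<dots> = (\<Sum>v\<in>V. \<Sum>i<M. pass_prob q M i * (1 - block_prob q M i ^ q) / M)"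
    by (intro sum.cong refl prb_chosen_root) auto
  also have "\<dots> = real (card V) / M * (\<Sum>i<M. pass_prob q M i * (1 - block_prob q M i ^ q))"
    by (simp add: sum_divide_distrib[symmetric])
  finally have "real (card V) / M * (\<Sum>i<M. pass_prob q M i * (1 - block_prob q M i ^ q)) \<le> card (chosen_set V H M \<omega>)"
    using \<omega> 1 unfolding mult_1 by linarith
  moreover have "\<not> e \<subseteq> chosen_set V H M \<omega>" if "e \<in> H" for e
    using that card_edge[OF that] fin_edge[OF that] by (intro chosen_set_independent) auto
  ultimately show ?thesis by (intro exI[of _ "chosen_set V H M \<omega>"]) (auto simp: chosen_set_def)
qed

end

section \<open>Growth of the recursion\<close>

lemma exp_le_one_minus:
  fixes x :: real
  assumes "0 \<le> x" "x \<le> 1 / 2"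
  shows "exp (- 2 * x) \<le> 1 - x"
proof -
  have "(1 + x * 2) * (1 - x) \<ge> 1"
    using mult_nonneg_nonneg[of x "1 - 2 * x"] assms by (simp add: algebra_simps)
  moreover have "1 + x * 2 \<le> exp (2 * x)" by (metis exp_ge_add_one_self mult.commute)
  then have "(1 + x * 2) * (1 - x) \<le> exp (2 * x) * (1 - x)"
    using assms by (intro mult_right_mono) auto
  ultimately have "1 \<le> exp (2 * x) * (1 - x)" by linarith
  then have "exp (- 2 * x) * 1 \<le> exp (- 2 * x) * (exp (2 * x) * (1 - x))" by simp
  also have "\<dots> = 1 - x" by (simp add: exp_add[symmetric] flip: mult.assoc)
  finally show ?thesis by simp
qed

lemma ln_le_2_sqrt: "M > 0 \<Longrightarrow> ln M \<le> 2 * sqrt M"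
  using ln_le_minus_one[of "sqrt M"] by (simp add: ln_sqrt)

text \<open>As long as \<open>M * block_prob q M i\<close> stays below \<open>\<theta>\<close>, each \<open>pass_prob q M i\<close> is at least \<open>1 / sqrt M\<close>,
  so the partial sums must reach \<open>\<theta>\<close> within \<open>M\<close> steps.\<close>

lemma sum_pass_prob_lower:
  assumes q: "q \<ge> 1" and M: "M \<ge> 1" and \<theta>_def: "\<theta> = (ln (real M) / 4) powr (1 / q)" and \<theta>: "\<theta> \<ge> 2"
  shows "\<theta> / 4 \<le> (\<Sum>i<M. pass_prob q M i * (1 - block_prob q M i ^ q))"
proof -
  have lnM: "ln (real M) / 4 > 0"
  proof (rule ccontr)
    assume "\<not> ln (real M) / 4 > 0"
    moreover have "ln (real M) \<ge> 0" using M by simp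
    ultimately have "ln (real M) = 0" by linarith
    then show False using \<theta> unfolding \<theta>_def by simp
  qed
  \<comment> \<open>As long as \<open>1 + S i \<le> \<theta>\<close>, this keeps
    \<open>block_prob q M i ^ q * M ^ q\<close> below \<open>ln M / 4\<close>; with the factor 2
    lost in \<open>exp_le_one_minus\<close>, \<open>pass_prob q M i\<close> stays above exp (- ln
    \<open>M\<close> / 2) = \<open>1 / sqrt M\<close>.\<close>
  have \<theta>q: "\<theta> ^ q = ln (real M) / 4"
    unfolding \<theta>_def using lnM q by (simp add: powr_powr flip: powr_realpow)
  define S where "S = (\<lambda>i. \<Sum>j<i. pass_prob q M j)"
  define t where "t = (\<lambda>i. pass_prob q M i * (1 - block_prob q M i ^ q))"
  have t_nonneg: "0 \<le> t i" if "i < M" for i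
    using pass_block_prob_bounds[OF that, of q] unfolding t_def by (auto intro!: mult_nonneg_nonneg power_le_one)
  have S_nonneg: "0 \<le> S i" if "i \<le> M" for i
    unfolding S_def using pass_block_prob_bounds that by (intro sum_nonneg) force
  have block_prob: "block_prob q M i = (1 + S i) / M" for i by (simp add: block_prob_def S_def)
  have small: "3 / 4 * pass_prob q M i \<le> t i \<and> 1 / sqrt M \<le> pass_prob q M i"
    if i: "i < M" "1 + S i \<le> \<theta>" for i
  proof -
    define x where "x = block_prob q M i ^ q"
    have x0: "0 \<le> x" using pass_block_prob_bounds[OF i(1), of q] by (simp add: x_def)
    have "x * M ^ q = (1 + S i) ^ q" using M unfolding x_def block_prob by (simp add: power_divide)
    also have "\<dots> \<le> ln M / 4" unfolding \<theta>q[symmetric] using i S_nonneg[of i] by (intro power_mono) auto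
    finally have xM: "x * M ^ q \<le> ln M / 4" .
    have "real M \<le> M ^ q" using q M by (simp add: self_le_power)
    then have "x * M \<le> x * M ^ q" using x0 by (intro mult_left_mono) auto
    also have "\<dots> \<le> M / 4" using xM ln_le_minus_one[of "real M"] M by simp
    finally have x1: "x \<le> 1 / 4" using M by (simp add: field_simps)
    have "1 / sqrt M = exp (- (ln M / 2))" using M by (simp add: exp_minus inverse_eq_divide exp_ln ln_sqrt[symmetric])
    also have "\<dots> \<le> exp (- 2 * x * (M ^ q))" using xM by simp
    also have "\<dots> = exp (- 2 * x) ^ (M ^ q)" by (subst exp_of_nat_mult[symmetric]) (simp add: mult.commute)
    also have "\<dots> \<le> (1 - x) ^ (M ^ q)" using exp_le_one_minus[of x] x0 x1 by (intro power_mono) auto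
    also have "\<dots> = pass_prob q M i" by (simp add: pass_prob_eq x_def)
    finally have g: "1 / sqrt M \<le> pass_prob q M i" .
    have "pass_prob q M i * (3 / 4) \<le> pass_prob q M i * (1 - x)"
      using x1 pass_block_prob_bounds[OF i(1), of q] by (intro mult_left_mono) auto
    then show ?thesis using g by (simp add: t_def x_def mult.commute)
  qed
  have sub: "sum t {..<i} \<le> sum t {..<M}" if "i \<le> M" for i
    using that t_nonneg by (intro sum_mono2) auto
  show ?thesis
  proof (cases "\<forall>i<M. 1 + S i \<le> \<theta>")
    \<comment> \<open>If \<open>\<theta>\<close> is never exceeded, the sum has \<open>M\<close>
      terms of order at least \<open>1 / sqrt M\<close>, and their total of order
      \<open>sqrt M\<close> already beats \<open>\<theta>\<close>.\<close>
    case True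
    have "\<theta> \<le> \<theta> ^ q" using \<theta> q by (intro self_le_power) auto
    then have "\<theta> \<le> 2 * sqrt M / 4" using \<theta>q ln_le_2_sqrt[of "real M"] M by linarith
    moreover have "(\<Sum>i<M. 3 / 4 * (1 / sqrt M)) \<le> sum t {..<M}"
      using small True by (intro sum_mono) fastforce
    moreover have "(\<Sum>i<M. 3 / 4 * (1 / sqrt M)) = 3 / 4 * sqrt M"
      using real_div_sqrt[of "real M"] by simp
    ultimately show ?thesis unfolding t_def[symmetric] using \<theta> by linarith
  next
    case False
    \<comment> \<open>At the first index past \<open>\<theta>\<close> all earlier terms lie in the
      controlled range, and \<open>3 / 4 * (\<theta> - 1) \<ge> \<theta> / 4\<close>.\<close>
    define i where "i = (LEAST i. i < M \<and> \<not> 1 + S i \<le> \<theta>)"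
    have i: "i < M" "\<not> 1 + S i \<le> \<theta>"
      using False LeastI_ex[of "\<lambda>i. i < M \<and> \<not> 1 + S i \<le> \<theta>"] unfolding i_def by auto
    have "1 + S j \<le> \<theta>" if "j < i" for j
      using not_less_Least[OF that[unfolded i_def]] that i by auto
    then have "(\<Sum>j<i. 3 / 4 * pass_prob q M j) \<le> sum t {..<i}"
      using small i by (intro sum_mono) fastforce
    then have "3 / 4 * S i \<le> sum t {..<M}"
      using sub[of i] i unfolding S_def sum_distrib_left by linarith
    then show ?thesis unfolding t_def[symmetric] using i \<theta> by linarith
  qed
qed

section \<open>Chains of rectangles\<close>

abbreviation cells :: "nat set \<times> nat set \<Rightarrow> (nat \<times> nat) set" where
  "cells x \<equiv> fst x \<times> snd x"

text \<open>Pairs of sides rather than sets of cells, so that row and column overlaps can be counted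
  separately.\<close>

definition rects :: "nat \<Rightarrow> nat \<Rightarrow> (nat set \<times> nat set) set" where
  "rects N r = {A. A \<subseteq> {..<N} \<and> card A = r} \<times> {B. B \<subseteq> {..<N} \<and> card B = r}"

definition row_set :: "(nat set \<times> nat set) list \<Rightarrow> nat set" where "row_set xs = \<Union>(fst ` set xs)"
definition col_set :: "(nat set \<times> nat set) list \<Rightarrow> nat set" where "col_set xs = \<Union>(snd ` set xs)"
definition covered :: "(nat set \<times> nat set) list \<Rightarrow> (nat \<times> nat) set" where "covered xs = \<Union>(cells ` set xs)"

lemma row_set_simps [simp]: "row_set [] = {}" "row_set (x # xs) = fst x \<union> row_set xs" by (auto simp: row_set_def)
lemma col_set_simps [simp]: "col_set [] = {}" "col_set (x # xs) = snd x \<union> col_set xs" by (auto simp: col_set_def)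
lemma covered_simps [simp]: "covered [] = {}" "covered (x # xs) = cells x \<union> covered xs"
  by (auto simp: covered_def)

lemma covered_subset: "covered xs \<subseteq> row_set xs \<times> col_set xs"
  by (auto simp: covered_def row_set_def col_set_def)

text \<open>The generic way to attach a rectangle to a chain: in a single cell, with no further common row or column.\<close>

definition corner_step :: "(nat set \<times> nat set) \<Rightarrow> (nat set \<times> nat set) list \<Rightarrow> bool" where
  "corner_step x xs \<longleftrightarrow> card (fst x \<inter> row_set xs) = 1 \<and> card (snd x \<inter> col_set xs) = 1"

fun good :: "nat \<Rightarrow> nat \<Rightarrow> (nat set \<times> nat set) list \<Rightarrow> bool" where
  "good N r [] = True"
| "good N r (x # xs) \<longleftrightarrow> good N r xs \<and> x \<in> rects N r \<and>
     (xs \<noteq> [] \<longrightarrow> cells x \<inter> covered xs \<noteq> {} \<and> corner_step x xs)"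

text \<open>A rectangle without new cells would cost no factor \<open>p\<close>, so the first moment
  could not control it; such rectangles are left out here and handled by
  \<open>rect_in_good\<close>.\<close>

definition bad_steps :: "nat \<Rightarrow> nat \<Rightarrow> (nat set \<times> nat set) list \<Rightarrow> (nat set \<times> nat set) set" where
  "bad_steps N r xs = {x \<in> rects N r. cells x \<inter> covered xs \<noteq> {} \<and> \<not> corner_step x xs \<and> \<not> cells x \<subseteq> covered xs}"

definition good_lists :: "nat \<Rightarrow> nat \<Rightarrow> nat \<Rightarrow> (nat set \<times> nat set) list set" where
  "good_lists N r m = {xs. length xs = m \<and> good N r xs}"

lemma rectsD: "x \<in> rects N r \<Longrightarrow> finite (fst x) \<and> finite (snd x) \<and> card (fst x) = r \<and> card (snd x) = r \<and>
    fst x \<subseteq> {..<N} \<and> snd x \<subseteq> {..<N}"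
  by (auto simp: rects_def intro: finite_subset[of _ "{..<N}"])

lemma finite_rects [simp]: "finite (rects N r)" by (simp add: rects_def)

lemma good_set: "good N r xs \<Longrightarrow> set xs \<subseteq> rects N r" by (induction xs) auto

lemma finite_good_lists [simp]: "finite (good_lists N r m)"
  by (rule finite_subset[of _ "{xs. set xs \<subseteq> rects N r \<and> length xs = m}"])
    (auto simp: good_lists_def finite_lists_length_eq dest: good_set)

lemma covered_fin: "set xs \<subseteq> rects N r \<Longrightarrow> finite (covered xs)"
  unfolding covered_def by (auto dest!: rectsD[OF subsetD])

lemma covered_sub: "set xs \<subseteq> rects N r \<Longrightarrow> covered xs \<subseteq> {..<N} \<times> {..<N}"
  unfolding covered_def by (fastforce dest!: rectsD[OF subsetD])

lemma row_set_card: "set xs \<subseteq> rects N r \<Longrightarrow> finite (row_set xs) \<and> card (row_set xs) \<le> r * length xs"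
proof (induction xs)
  case (Cons x xs)
  then have "card (fst x \<union> row_set xs) \<le> r + card (row_set xs)"
    using card_Un_le[of "fst x" "row_set xs"] rectsD[of x N r] by simp
  then show ?case using Cons rectsD[of x N r] by simp
qed simp

lemma col_set_card: "set xs \<subseteq> rects N r \<Longrightarrow> finite (col_set xs) \<and> card (col_set xs) \<le> r * length xs"
proof (induction xs)
  case (Cons x xs)
  then have "card (snd x \<union> col_set xs) \<le> r + card (col_set xs)"
    using card_Un_le[of "snd x" "col_set xs"] rectsD[of x N r] by simp
  then show ?case using Cons rectsD[of x N r] by simp
qed simp

lemma cells_inter_covered: "cells x \<inter> covered xs \<subseteq> (fst x \<inter> row_set xs) \<times> (snd x \<inter> col_set xs)"
  using covered_subset[of xs] by auto

lemma corner_step_unique: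
  assumes "corner_step x xs" "cells x \<inter> covered xs \<noteq> {}"
  obtains a b where "fst x \<inter> row_set xs = {a}" "snd x \<inter> col_set xs = {b}" "cells x \<inter> covered xs = {(a, b)}"
proof -
  obtain a b where ab: "fst x \<inter> row_set xs = {a}" "snd x \<inter> col_set xs = {b}"
    using assms(1) unfolding corner_step_def by (metis card_1_singletonE)
  then have "cells x \<inter> covered xs \<subseteq> {(a, b)}" using cells_inter_covered[of x xs] by auto
  then show thesis using that ab assms(2) by blast
qed

text \<open>A good chain contains no unexpected rectangle. If the given one uses a row of the head
  \<open>A' \<times> B'\<close> that is new to the chain, the cells of that row force
  \<open>B = B'\<close>; since at most one column of \<open>B'\<close> is old and
  \<open>r \<ge> 2\<close>, a new column then forces \<open>A = A'\<close>. Columns are symmetric.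
  Otherwise it meets the head at most in the corner cell, which the rest of the chain covers
  already.\<close>

lemma rect_in_good:
  assumes r: "r \<ge> 2" and AB: "finite A" "finite B" "card A = r" "card B = r"
  shows "good N r xs \<Longrightarrow> A \<times> B \<subseteq> covered xs \<Longrightarrow> (A, B) \<in> set xs"
proof (induction xs)
  case Nil
  then have "A = {} \<or> B = {}" by auto
  then show ?case using AB r by auto
next
  case (Cons x xs)
  obtain A' B' where x: "x = (A', B')" by force
  have x': "finite A'" "finite B'" "card A' = r" "card B' = r" using rectsD[of x N r] Cons.prems x by auto
  have le1: "card (A' \<inter> row_set xs) \<le> 1" "card (B' \<inter> col_set xs) \<le> 1"
    using Cons.prems x by (cases "xs = []"; auto simp: corner_step_def)+
  have cov: "A \<times> B \<subseteq> A' \<times> B' \<union> covered xs" using Cons.prems x by simp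
  have cs: "covered xs \<subseteq> row_set xs \<times> col_set xs" by (rule covered_subset)
  have "(A, B) = (A', B') \<or> A \<times> B \<subseteq> covered xs"
  proof (cases "(\<exists>a\<in>A \<inter> A'. a \<notin> row_set xs) \<or> (\<exists>b\<in>B \<inter> B'. b \<notin> col_set xs)")
    case True
    then show ?thesis
    proof
      assume "\<exists>a\<in>A \<inter> A'. a \<notin> row_set xs"
      then have "B \<subseteq> B'" using cov cs by blast
      then have B: "B = B'" using AB x' by (simp add: card_subset_eq)
      have "\<not> B' \<subseteq> B' \<inter> col_set xs" using le1(2) x' r card_mono[of "B' \<inter> col_set xs" B'] by auto
      then obtain b where "b \<in> B'" "b \<notin> col_set xs" by blast
      then have "A \<subseteq> A'" using cov cs B by blast
      then show ?thesis using B AB x' by (simp add: card_subset_eq)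
    next
      assume "\<exists>b\<in>B \<inter> B'. b \<notin> col_set xs"
      then have "A \<subseteq> A'" using cov cs by blast
      then have A: "A = A'" using AB x' by (simp add: card_subset_eq)
      have "\<not> A' \<subseteq> A' \<inter> row_set xs" using le1(1) x' r card_mono[of "A' \<inter> row_set xs" A'] by auto
      then obtain a where "a \<in> A'" "a \<notin> row_set xs" by blast
      then have "B \<subseteq> B'" using cov cs A by blast
      then show ?thesis using A AB x' by (simp add: card_subset_eq)
    qed
  next
    case False
    show ?thesis
    proof (cases "xs = []")
      case True
      have "A \<times> B = {}" using False cov unfolding True by auto
      then have "A = {} \<or> B = {}" by auto
      then show ?thesis using AB r by auto
    next
      case ne: False
      obtain a b where "fst x \<inter> row_set xs = {a}" "snd x \<inter> col_set xs = {b}" "cells x \<inter> covered xs = {(a, b)}"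
        using Cons.prems ne corner_step_unique[of x xs] by auto
      then have "A \<times> B \<subseteq> covered xs" using False cov x by fastforce
      then show ?thesis by simp
    qed
  qed
  then show ?case using Cons x by auto
qed

section \<open>Weight of one attachment, by shared rows and columns\<close>

lemma card_trace_le:
  assumes "finite A'" "card A' \<le> r"
  shows "card {A. A \<subseteq> {..<N} \<and> card A = r \<and> A \<inter> X = A'} \<le> N ^ (r - card A')"
proof -
  define C where "C = {C. C \<subseteq> {..<N} \<and> card C = r - card A'}"
  have finC: "finite C" unfolding C_def by simp
  have "{A. A \<subseteq> {..<N} \<and> card A = r \<and> A \<inter> X = A'} \<subseteq> (\<lambda>C. A' \<union> C) ` C"
  proof
    fix A assume A: "A \<in> {A. A \<subseteq> {..<N} \<and> card A = r \<and> A \<inter> X = A'}"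
    then have "A - A' \<in> C" using assms unfolding C_def by (auto simp: card_Diff_subset)
    moreover have "A = A' \<union> (A - A')" using A by auto
    ultimately show "A \<in> (\<lambda>C. A' \<union> C) ` C" by blast
  qed
  then have "card {A. A \<subseteq> {..<N} \<and> card A = r \<and> A \<inter> X = A'} \<le> card C"
    by (rule surj_card_le[OF finC])
  also have "card C = N choose (r - card A')" unfolding C_def by (subst n_subsets) auto
  also have "\<dots> \<le> N ^ (r - card A')"
    by (cases "r - card A' \<le> N") (auto simp: binomial_le_pow binomial_eq_0)
  finally show ?thesis .
qed

lemma sum_le_card_times_fibre:
  fixes w :: "'x \<Rightarrow> real"
  assumes fin: "finite I" "finite G" and w: "\<And>x. x \<in> G \<Longrightarrow> 0 \<le> w x"
    and cover: "\<And>x. x \<in> G \<Longrightarrow> \<exists>y\<in>I. x \<in> T y" and b: "\<And>y. y \<in> I \<Longrightarrow> sum w (G \<inter> T y) \<le> b"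
  shows "sum w G \<le> real (card I) * b"
proof -
  have "w x \<le> (\<Sum>y\<in>I. if x \<in> T y then w x else 0)" if x: "x \<in> G" for x
  proof -
    obtain y where y: "y \<in> I" "x \<in> T y" using cover[OF x] by blast
    have "(if x \<in> T y then w x else 0) \<le> (\<Sum>y\<in>I. if x \<in> T y then w x else 0)"
      using fin y w[OF x] by (intro member_le_sum) auto
    then show ?thesis using y by simp
  qed
  then have "sum w G \<le> (\<Sum>x\<in>G. \<Sum>y\<in>I. if x \<in> T y then w x else 0)" by (rule sum_mono)
  also have "\<dots> = (\<Sum>y\<in>I. \<Sum>x\<in>G. if x \<in> T y then w x else 0)" by (rule sum.swap)
  also have "\<dots> = (\<Sum>y\<in>I. sum w (G \<inter> T y))" using fin by (simp add: sum.inter_restrict)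
  also have "\<dots> \<le> (\<Sum>y\<in>I. b)" by (rule sum_mono) (rule b)
  finally show ?thesis by simp
qed

text \<open>The trace on rows and columns alone fixes the power of \<open>N\<close> in the count;
  the cells actually shared may be fewer than \<open>A' \<times> B'\<close>, which only adds factors
  \<open>p\<close>.\<close>

definition fibre :: "nat \<Rightarrow> nat \<Rightarrow> (nat set \<times> nat set) list \<Rightarrow> nat set \<Rightarrow> nat set \<Rightarrow> (nat set \<times> nat set) set" where
  "fibre N r xs A' B' = {x \<in> rects N r. fst x \<inter> row_set xs = A' \<and> snd x \<inter> col_set xs = B'}"

lemma finite_fibre [simp]: "finite (fibre N r xs A' B')" unfolding fibre_def by simp

lemma card_fibre_le:
  assumes "finite A'" "finite B'" "card A' \<le> r" "card B' \<le> r"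
  shows "card (fibre N r xs A' B') \<le> N ^ (2 * r - card A' - card B')"
proof -
  have eq: "fibre N r xs A' B' = {A. A \<subseteq> {..<N} \<and> card A = r \<and> A \<inter> row_set xs = A'} \<times>
     {B. B \<subseteq> {..<N} \<and> card B = r \<and> B \<inter> col_set xs = B'}"
    unfolding fibre_def rects_def by auto
  have "card (fibre N r xs A' B') \<le> N ^ (r - card A') * N ^ (r - card B')"
    unfolding eq card_cartesian_product using assms by (intro mult_le_mono card_trace_le)
  also have "\<dots> = N ^ (2 * r - card A' - card B')"
    using assms by (subst power_add[symmetric]) (auto intro!: arg_cong[of _ _ "power N"])
  finally show ?thesis .
qed

text \<open>\<open>p ^ card (covered xs)\<close> is the probability that the whole chain is present,
  so every new cell costs a factor \<open>p\<close>, while the free rows and columns gain powers of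
  \<open>N\<close>.\<close>

lemma fibre_weight_le:
  fixes p :: real
  assumes p: "0 \<le> p" "p \<le> 1" and xs: "set xs \<subseteq> rects N r"
    and AB: "finite A'" "finite B'" "card A' \<le> r" "card B' \<le> r"
    and F: "F \<subseteq> fibre N r xs A' B'" and k: "\<And>x. x \<in> F \<Longrightarrow> k \<le> card (cells x - covered xs)"
  shows "(\<Sum>x\<in>F. p ^ card (covered (x # xs))) \<le>
    p ^ card (covered xs) * (real N ^ (2 * r - card A' - card B') * p ^ k)"
proof -
  have "(\<Sum>x\<in>F. p ^ card (covered (x # xs))) \<le> (\<Sum>x\<in>F. p ^ card (covered xs) * p ^ k)"
  proof (rule sum_mono)
    fix x assume x: "x \<in> F"
    then have fx: "finite (cells x)" using F rectsD[of x N r] by (auto simp: fibre_def)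
    have "card (covered (x # xs)) = card (covered xs \<union> (cells x - covered xs))"
      by (rule arg_cong[of _ _ card]) auto
    also have "\<dots> = card (covered xs) + card (cells x - covered xs)"
      using fx covered_fin[OF xs] by (intro card_Un_disjoint) auto
    finally have "p ^ card (covered (x # xs)) = p ^ card (covered xs) * p ^ card (cells x - covered xs)"
      by (simp add: power_add)
    also have "\<dots> \<le> p ^ card (covered xs) * p ^ k"
      using p k[OF x] by (intro mult_left_mono power_decreasing) auto
    finally show "p ^ card (covered (x # xs)) \<le> p ^ card (covered xs) * p ^ k" .
  qed
  also have "\<dots> = real (card F) * (p ^ card (covered xs) * p ^ k)" by simp
  also have "\<dots> \<le> real N ^ (2 * r - card A' - card B') * (p ^ card (covered xs) * p ^ k)"
  proof (rule mult_right_mono)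
    have "card F \<le> card (fibre N r xs A' B')" using F by (intro card_mono) auto
    also have "\<dots> \<le> N ^ (2 * r - card A' - card B')" by (rule card_fibre_le[OF AB])
    finally show "real (card F) \<le> real N ^ (2 * r - card A' - card B')"
      by (metis of_nat_le_iff of_nat_power)
  qed (use p in auto)
  finally show ?thesis by (simp add: mult_ac)
qed

text \<open>At most \<open>(r * length xs)^2\<close> positions for the corner, each with at most
  \<open>N ^ (2 * r - 2)\<close> rectangles that add \<open>r^2 - 1\<close> new cells.\<close>

lemma good_step_weight:
  fixes p :: real
  assumes p: "0 \<le> p" "p \<le> 1" and r: "r \<ge> 2" and xs: "good N r xs" "xs \<noteq> []"
  shows "(\<Sum>x\<in>{x. good N r (x # xs)}. p ^ card (covered (x # xs))) \<le>
    p ^ card (covered xs) * ((real r * length xs)\<^sup>2 * (real N ^ (2 * r - 2) * p ^ (r\<^sup>2 - 1)))"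
proof -
  note sx = good_set[OF xs(1)]
  define G where "G = {x. good N r (x # xs)}"
  have finG: "finite G" by (rule finite_subset[of _ "rects N r"]) (auto simp: G_def)
  have *: "\<exists>a\<in>row_set xs. \<exists>b\<in>col_set xs. x \<in> fibre N r xs {a} {b}" "r\<^sup>2 - 1 \<le> card (cells x - covered xs)" if x: "x \<in> G" for x
  proof -
    obtain a b where ab: "fst x \<inter> row_set xs = {a}" "snd x \<inter> col_set xs = {b}" "cells x \<inter> covered xs = {(a, b)}"
      using x xs corner_step_unique[of x xs] unfolding G_def by auto
    have "a \<in> row_set xs" "b \<in> col_set xs" "x \<in> fibre N r xs {a} {b}"
      using ab x unfolding G_def fibre_def by auto
    then show "\<exists>a\<in>row_set xs. \<exists>b\<in>col_set xs. x \<in> fibre N r xs {a} {b}" by blast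
    have "cells x - covered xs = cells x - {(a, b)}" using ab(3) by blast
    moreover have "(a, b) \<in> cells x" using ab(3) by blast
    ultimately show "r\<^sup>2 - 1 \<le> card (cells x - covered xs)"
      using rectsD[of x N r] x by (simp add: G_def card_cartesian_product power2_eq_square)
  qed
  have fin: "finite (row_set xs)" "finite (col_set xs)" using row_set_card[OF sx] col_set_card[OF sx] by auto
  define w where "w = (\<lambda>x. p ^ card (covered (x # xs)))"
  define b where "b = p ^ card (covered xs) * (real N ^ (2 * r - 2) * p ^ (r\<^sup>2 - 1))"
  have b0: "0 \<le> b" using p by (simp add: b_def)
  have "sum w G \<le> real (card (row_set xs \<times> col_set xs)) * b"
  proof (rule sum_le_card_times_fibre[where T = "\<lambda>y. fibre N r xs {fst y} {snd y}"])
    fix y assume "y \<in> row_set xs \<times> col_set xs"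
    have "sum w (G \<inter> fibre N r xs {fst y} {snd y}) \<le>
       p ^ card (covered xs) * (real N ^ (2 * r - card {fst y} - card {snd y}) * p ^ (r\<^sup>2 - 1))"
      unfolding w_def using r *(2) by (intro fibre_weight_le p sx) auto
    then show "sum w (G \<inter> fibre N r xs {fst y} {snd y}) \<le> b"
      by (simp add: b_def numeral_2_eq_2)
  qed (use fin finG p *(1) in \<open>force simp: w_def\<close>)+
  also have "\<dots> = real (card (row_set xs) * card (col_set xs)) * b" by (simp add: card_cartesian_product)
  also have "\<dots> \<le> (real r * length xs)\<^sup>2 * b"
  proof (rule mult_right_mono[OF _ b0])
    have "card (row_set xs) * card (col_set xs) \<le> (r * length xs) * (r * length xs)"
      using row_set_card[OF sx] col_set_card[OF sx] by (intro mult_le_mono) auto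
    then show "real (card (row_set xs) * card (col_set xs)) \<le> (real r * length xs)\<^sup>2"
      unfolding power2_eq_square of_nat_mult[symmetric] of_nat_le_iff .
  qed
  finally show ?thesis by (simp add: G_def w_def b_def mult_ac)
qed

text \<open>The traces are pairs of subsets of the rows and columns in use, hence the factor
  \<open>4 ^ (r * length xs)\<close>; \<open>\<eta>\<close> bounds the contribution of every trace
  larger than a single corner.\<close>

lemma bad_step_weight:
  fixes p \<eta> :: real
  assumes p: "0 \<le> p" "p \<le> 1" and r: "r \<ge> 2" and xs: "good N r xs"
    and \<eta>: "\<And>a b. a \<in> {1..r} \<Longrightarrow> b \<in> {1..r} \<Longrightarrow> (a, b) \<noteq> (1, 1) \<Longrightarrow>
      real N ^ (2 * r - a - b) * p ^ max 1 (r\<^sup>2 - a * b) \<le> \<eta>" and \<eta>0: "0 \<le> \<eta>"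
  shows "(\<Sum>x\<in>bad_steps N r xs. p ^ card (covered (x # xs))) \<le>
    p ^ card (covered xs) * (4 ^ (r * length xs) * \<eta>)"
proof -
  note sx = good_set[OF xs]
  have fin: "finite (row_set xs)" "finite (col_set xs)" using row_set_card[OF sx] col_set_card[OF sx] by auto
  define G where "G = bad_steps N r xs"
  have finG: "finite G" unfolding G_def bad_steps_def by simp
  define w where "w = (\<lambda>x. p ^ card (covered (x # xs)))"
  define b where "b = p ^ card (covered xs) * \<eta>"
  have b0: "0 \<le> b" using p \<eta>0 by (simp add: b_def)
  define I where "I = Pow (row_set xs) \<times> Pow (col_set xs)"
  have "sum w G \<le> real (card I) * b"
  proof (rule sum_le_card_times_fibre[where T = "\<lambda>y. fibre N r xs (fst y) (snd y)"])
    fix x assume "x \<in> G"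
    then show "\<exists>y\<in>I. x \<in> fibre N r xs (fst y) (snd y)"
      by (intro bexI[of _ "(fst x \<inter> row_set xs, snd x \<inter> col_set xs)"])
        (auto simp: I_def G_def fibre_def bad_steps_def)
  next
    fix y assume y: "y \<in> I"
    define A' B' where "A' = fst y" and "B' = snd y"
    define F where "F = G \<inter> fibre N r xs A' B'"
    have "sum w F \<le> b"
    proof (cases "F = {}")
      case False
      then obtain x0 where "x0 \<in> F" by blast
      have F: "A' \<times> B' \<noteq> {}" "card A' \<le> r" "card B' \<le> r" "(card A', card B') \<noteq> (1, 1)" "finite A'" "finite B'"
        "max 1 (r\<^sup>2 - card A' * card B') \<le> card (cells x - covered xs)" if x: "x \<in> F" for x
      proof -
        have xr: "x \<in> rects N r" and ne: "cells x \<inter> covered xs \<noteq> {}" "\<not> corner_step x xs" "\<not> cells x \<subseteq> covered xs"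
          using x by (auto simp: F_def G_def bad_steps_def)
        have A': "A' = fst x \<inter> row_set xs" "B' = snd x \<inter> col_set xs" using x by (auto simp: F_def fibre_def)
        note rD = rectsD[OF xr]
        have ss: "cells x \<inter> covered xs \<subseteq> A' \<times> B'" unfolding A' by (rule cells_inter_covered)
        show "A' \<times> B' \<noteq> {}" using ss ne by blast
        show "card A' \<le> r" "card B' \<le> r" using rD unfolding A' by (metis card_mono Int_lower1)+
        show fAB: "finite A'" "finite B'" using rD unfolding A' by auto
        show "(card A', card B') \<noteq> (1, 1)" using ne A' by (simp add: corner_step_def)
        have "card (cells x) - card (A' \<times> B') \<le> card (cells x - A' \<times> B')"
          by (rule diff_card_le_card_Diff) (use fAB in simp)
        also have "\<dots> \<le> card (cells x - covered xs)" using ss rD by (intro card_mono) auto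
        finally have "r\<^sup>2 - card A' * card B' \<le> card (cells x - covered xs)"
          using rD by (simp add: card_cartesian_product power2_eq_square)
        \<comment> \<open>When the trace is the full grid, the count above gives no new cell; the
          last condition in \<open>bad_steps\<close> provides one, whence the
          \<open>max 1\<close>.\<close>
        moreover have "card (cells x - covered xs) \<noteq> 0" using ne rD by (simp add: card_eq_0_iff)
        ultimately show "max 1 (r\<^sup>2 - card A' * card B') \<le> card (cells x - covered xs)" by simp
      qed
      note F0 = F[OF \<open>x0 \<in> F\<close>]
      have "sum w F \<le> p ^ card (covered xs) *
          (real N ^ (2 * r - card A' - card B') * p ^ max 1 (r\<^sup>2 - card A' * card B'))"
        unfolding w_def using F0 F(7) by (intro fibre_weight_le p sx) (auto simp: F_def)
      also have "\<dots> \<le> b"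
        unfolding b_def using F0 p
        by (intro mult_left_mono \<eta>) (auto simp: Suc_le_eq card_gt_0_iff)
      finally show ?thesis .
    qed (use b0 in auto)
    then show "sum w (G \<inter> fibre N r xs (fst y) (snd y)) \<le> b" by (simp add: F_def A'_def B'_def)
  qed (use fin finG p in \<open>auto simp: w_def I_def\<close>)
  also have "\<dots> \<le> 4 ^ (r * length xs) * b"
  proof (rule mult_right_mono[OF _ b0])
    have "card I = 2 ^ card (row_set xs) * 2 ^ card (col_set xs)"
      unfolding I_def using fin by (simp add: card_cartesian_product card_Pow)
    also have "\<dots> \<le> 2 ^ (r * length xs) * 2 ^ (r * length xs)"
      using row_set_card[OF sx] col_set_card[OF sx] by (intro mult_le_mono power_increasing) auto
    also have "\<dots> = 4 ^ (r * length xs)" by (simp flip: power_mult_distrib)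
    finally have "real (card I) \<le> real (4 ^ (r * length xs))" unfolding of_nat_le_iff .
    then show "real (card I) \<le> 4 ^ (r * length xs)" by simp
  qed
  finally show ?thesis by (simp add: G_def w_def b_def mult_ac)
qed

section \<open>Expected numbers of good and bad chains\<close>

lemma sum_Cons_Sigma:
  fixes f :: "'x list \<Rightarrow> real"
  assumes "finite A" "\<And>xs. xs \<in> A \<Longrightarrow> finite (B xs)"
  shows "sum f ((\<lambda>(xs, x). x # xs) ` Sigma A B) = (\<Sum>xs\<in>A. \<Sum>x\<in>B xs. f (x # xs))"
proof -
  have "sum f ((\<lambda>(xs, x). x # xs) ` Sigma A B) = (\<Sum>(xs, x)\<in>Sigma A B. f (x # xs))"
    by (subst sum.reindex) (auto simp: inj_on_def case_prod_unfold)
  also have "\<dots> = (\<Sum>xs\<in>A. \<Sum>x\<in>B xs. f (x # xs))"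
    using assms by (subst sum.Sigma) auto
  finally show ?thesis .
qed

text \<open>The minimal obstructions: a good chain spoiled by its head alone. Once none of them is
  present, every chain of distinct rectangles is good, by induction on its length.\<close>

definition bad_lists :: "nat \<Rightarrow> nat \<Rightarrow> nat \<Rightarrow> (nat set \<times> nat set) list set" where
  "bad_lists N r g = (\<lambda>(xs, x). x # xs) ` Sigma (\<Union>m\<in>{1..<g}. good_lists N r m) (bad_steps N r)"

lemma finite_bad_steps [simp]: "finite (bad_steps N r xs)" by (simp add: bad_steps_def)

lemma finite_bad_lists [simp]: "finite (bad_lists N r g)"
  unfolding bad_lists_def by (intro finite_imageI finite_SigmaI) auto

lemma good_lists_1: "good_lists N r 1 = (\<lambda>x. [x]) ` rects N r"
proof (intro equalityI subsetI)
  fix xs assume "xs \<in> good_lists N r 1"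
  then show "xs \<in> (\<lambda>x. [x]) ` rects N r"
    by (cases xs) (auto simp: good_lists_def)
qed (auto simp: good_lists_def)

lemma good_lists_Suc:
  assumes "m \<ge> 1"
  shows "good_lists N r (Suc m) = (\<lambda>(xs, x). x # xs) ` Sigma (good_lists N r m) (\<lambda>xs. {x. good N r (x # xs)})"
proof (intro equalityI subsetI)
  fix ys assume "ys \<in> good_lists N r (Suc m)"
  then show "ys \<in> (\<lambda>(xs, x). x # xs) ` Sigma (good_lists N r m) (\<lambda>xs. {x. good N r (x # xs)})"
    by (cases ys) (force simp: good_lists_def)+
qed (auto simp: good_lists_def, blast)

lemma finite_good_steps: "finite {x. good N r (x # xs)}"
  by (rule finite_subset[of _ "rects N r"]) auto

lemma card_rects: "card (rects N r) \<le> N ^ (2 * r)"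
proof -
  have "N choose r \<le> N ^ r" by (cases "r \<le> N") (auto simp: binomial_le_pow binomial_eq_0)
  moreover have "card (rects N r) = (N choose r) * (N choose r)"
    unfolding rects_def card_cartesian_product by (subst (1 2) n_subsets) auto
  ultimately show ?thesis by (simp add: mult_2 power_add mult_le_mono)
qed

context
  fixes N r :: nat and p \<kappa> :: real
  assumes p: "0 \<le> p" "p \<le> 1" and r: "r \<ge> 2"
    and \<kappa>_def: "\<kappa> = real N ^ (2 * r - 2) * p ^ (r\<^sup>2 - 1)" and \<kappa>: "\<kappa> \<ge> 1"
begin

text \<open>The expected number of cells is \<open>N^2 p\<close>, and \<open>\<kappa>\<close> bounds
  the expected number of rectangles through a given present cell.\<close>

lemma rect_weight: "(\<Sum>xs\<in>good_lists N r 1. p ^ card (covered xs)) \<le> (real N)\<^sup>2 * p * \<kappa>"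
proof -
  have r2: "2 * r = 2 + (2 * r - 2)" "r\<^sup>2 = Suc (r\<^sup>2 - 1)" using r by auto
  have "(\<Sum>xs\<in>good_lists N r 1. p ^ card (covered xs)) = (\<Sum>x\<in>rects N r. p ^ card (cells x))"
    unfolding good_lists_1 by (subst sum.reindex) (auto simp: inj_on_def)
  also have "\<dots> = (\<Sum>x\<in>rects N r. p ^ r\<^sup>2)"
    by (intro sum.cong refl) (auto dest!: rectsD simp: card_cartesian_product power2_eq_square)
  also have "\<dots> = real (card (rects N r)) * p ^ r\<^sup>2" by simp
  also have "\<dots> \<le> real (N ^ (2 * r)) * p ^ r\<^sup>2"
    using card_rects[of N r] p by (intro mult_right_mono) (auto simp del: of_nat_power)
  also have "\<dots> = (real N)\<^sup>2 * p * \<kappa>"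
    unfolding \<kappa>_def of_nat_power by (subst r2(1), subst r2(2)) (simp add: power_add power2_eq_square)
  finally show ?thesis .
qed

text \<open>Each attachment costs at most the factor of \<open>good_step_weight\<close>, with
  \<open>length xs\<close> relaxed to \<open>g\<close> so that the ratio is the same in every
  step.\<close>

lemma good_lists_weight:
  assumes "1 \<le> m" "m \<le> g"
  shows "(\<Sum>xs\<in>good_lists N r m. p ^ card (covered xs)) \<le> (real N)\<^sup>2 * p * ((real r * g)\<^sup>2 * \<kappa>) ^ m"
  using assms
proof (induction m rule: dec_induct)
  case base
  have "1 * 1 \<le> r * g" using r base by (intro mult_le_mono) auto
  then have "1 \<le> real r * real g" by (metis mult_1 of_nat_1 of_nat_le_iff of_nat_mult)
  then have "1 \<le> (real r * g)\<^sup>2" by (simp add: one_le_power)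
  then have "(real N)\<^sup>2 * p * \<kappa> * 1 \<le> (real N)\<^sup>2 * p * \<kappa> * (real r * g)\<^sup>2"
    using p \<kappa> by (intro mult_left_mono) auto
  then show ?case using rect_weight by (simp add: mult_ac)
next
  case (step m)
  define K where "K = (real r * g)\<^sup>2 * \<kappa>"
  have K0: "0 \<le> K" using \<kappa> by (simp add: K_def)
  have "(\<Sum>xs\<in>good_lists N r (Suc m). p ^ card (covered xs)) =
     (\<Sum>xs\<in>good_lists N r m. \<Sum>x\<in>{x. good N r (x # xs)}. p ^ card (covered (x # xs)))"
    unfolding good_lists_Suc[OF step.hyps(1)] by (rule sum_Cons_Sigma) (use finite_good_steps in auto)
  also have "\<dots> \<le> (\<Sum>xs\<in>good_lists N r m. p ^ card (covered xs) * K)"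
  proof (rule sum_mono)
    fix xs assume xs: "xs \<in> good_lists N r m"
    then have "xs \<noteq> []" using step by (auto simp: good_lists_def)
    then have "(\<Sum>x\<in>{x. good N r (x # xs)}. p ^ card (covered (x # xs))) \<le>
       p ^ card (covered xs) * ((real r * length xs)\<^sup>2 * \<kappa>)"
      unfolding \<kappa>_def using xs by (intro good_step_weight p r) (auto simp: good_lists_def)
    also have "\<dots> \<le> p ^ card (covered xs) * K"
      unfolding K_def using xs step p \<kappa>
      by (intro mult_left_mono mult_right_mono power_mono) (auto simp: good_lists_def)
    finally show "(\<Sum>x\<in>{x. good N r (x # xs)}. p ^ card (covered (x # xs))) \<le> p ^ card (covered xs) * K" .
  qed
  also have "\<dots> = (\<Sum>xs\<in>good_lists N r m. p ^ card (covered xs)) * K" by (simp add: sum_distrib_right)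
  also have "\<dots> \<le> (real N)\<^sup>2 * p * K ^ m * K"
    using step K0 unfolding K_def by (intro mult_right_mono) auto
  finally show ?case by (simp add: K_def mult_ac)
qed

text \<open>A bad step occurs only once, at the end, so its single factor \<open>\<eta>\<close> has
  to absorb whatever all the good steps gain. The sum over lengths is bounded by \<open>g\<close>
  times the largest term.\<close>

lemma bad_lists_weight:
  assumes \<eta>: "\<And>a b. a \<in> {1..r} \<Longrightarrow> b \<in> {1..r} \<Longrightarrow> (a, b) \<noteq> (1, 1) \<Longrightarrow>
      real N ^ (2 * r - a - b) * p ^ max 1 (r\<^sup>2 - a * b) \<le> \<eta>" and \<eta>0: "0 \<le> \<eta>"
  shows "(\<Sum>xs\<in>bad_lists N r g. p ^ card (covered xs)) \<le>
    (real N)\<^sup>2 * p * (g * ((real r * g)\<^sup>2 * \<kappa>) ^ g * 4 ^ (r * g) * \<eta>)"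
proof -
  define K where "K = (real r * g)\<^sup>2 * \<kappa>"
  have "(\<Sum>xs\<in>bad_lists N r g. p ^ card (covered xs)) =
     (\<Sum>xs\<in>(\<Union>m\<in>{1..<g}. good_lists N r m). \<Sum>x\<in>bad_steps N r xs. p ^ card (covered (x # xs)))"
    unfolding bad_lists_def by (rule sum_Cons_Sigma) auto
  also have "\<dots> = (\<Sum>m\<in>{1..<g}. \<Sum>xs\<in>good_lists N r m. \<Sum>x\<in>bad_steps N r xs. p ^ card (covered (x # xs)))"
  proof (rule sum.UNION_disjoint)
    show "\<forall>i\<in>{1..<g}. \<forall>j\<in>{1..<g}. i \<noteq> j \<longrightarrow> good_lists N r i \<inter> good_lists N r j = {}"
      by (auto simp: good_lists_def)
  qed simp_all
  also have "\<dots> \<le> (\<Sum>m\<in>{1..<g}. (real N)\<^sup>2 * p * K ^ g * (4 ^ (r * g) * \<eta>))"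
  proof (rule sum_mono)
    fix m assume m: "m \<in> {1..<g}"
    have "1 * 1 \<le> r * g" using r m by (intro mult_le_mono) auto
    then have "1 \<le> real r * real g" by (metis mult_1 of_nat_1 of_nat_le_iff of_nat_mult)
    then have K1: "1 * 1 \<le> K" unfolding K_def using \<kappa> by (intro mult_mono) (auto simp: one_le_power)
    have "(\<Sum>xs\<in>good_lists N r m. \<Sum>x\<in>bad_steps N r xs. p ^ card (covered (x # xs))) \<le>
       (\<Sum>xs\<in>good_lists N r m. p ^ card (covered xs) * (4 ^ (r * g) * \<eta>))"
    proof (rule sum_mono)
      fix xs assume xs: "xs \<in> good_lists N r m"
      have "(\<Sum>x\<in>bad_steps N r xs. p ^ card (covered (x # xs))) \<le>
         p ^ card (covered xs) * (4 ^ (r * length xs) * \<eta>)"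
        using xs by (intro bad_step_weight p r \<eta> \<eta>0) (auto simp: good_lists_def)
      also have "\<dots> \<le> p ^ card (covered xs) * (4 ^ (r * g) * \<eta>)"
        using xs m p \<eta>0 by (intro mult_left_mono mult_right_mono power_increasing) (auto simp: good_lists_def)
      finally show "(\<Sum>x\<in>bad_steps N r xs. p ^ card (covered (x # xs))) \<le>
         p ^ card (covered xs) * (4 ^ (r * g) * \<eta>)" .
    qed
    also have "\<dots> = (\<Sum>xs\<in>good_lists N r m. p ^ card (covered xs)) * (4 ^ (r * g) * \<eta>)"
      by (simp add: sum_distrib_right)
    also have "\<dots> \<le> (real N)\<^sup>2 * p * K ^ m * (4 ^ (r * g) * \<eta>)"
      unfolding K_def using m \<eta>0 by (intro mult_right_mono good_lists_weight) auto
    also have "\<dots> \<le> (real N)\<^sup>2 * p * K ^ g * (4 ^ (r * g) * \<eta>)"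
      using m \<eta>0 K1 p by (intro mult_right_mono mult_left_mono power_increasing) auto
    finally show "(\<Sum>xs\<in>good_lists N r m. \<Sum>x\<in>bad_steps N r xs. p ^ card (covered (x # xs))) \<le>
       (real N)\<^sup>2 * p * K ^ g * (4 ^ (r * g) * \<eta>)" .
  qed
  also have "\<dots> = real (g - 1) * ((real N)\<^sup>2 * p * K ^ g * (4 ^ (r * g) * \<eta>))" by simp
  also have "\<dots> \<le> real g * ((real N)\<^sup>2 * p * K ^ g * (4 ^ (r * g) * \<eta>))"
    using p \<eta>0 \<kappa> by (intro mult_right_mono) (auto simp: K_def)
  finally show ?thesis by (simp add: K_def mult_ac)
qed

end

section \<open>Deletion in a random set of cells\<close>

lemma prob_Pi_bernoulli_subset:
  assumes "finite V" "U \<subseteq> V" "0 \<le> p" "p \<le> 1"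
  shows "measure_pmf.prob (Pi_pmf V False (\<lambda>_. bernoulli_pmf p)) {\<omega>. \<forall>y\<in>U. \<omega> y} = p ^ card U"
proof -
  have "{\<omega>. \<forall>y\<in>U. \<omega> y} = Pi V (\<lambda>y. if y \<in> U then {True} else UNIV)"
    using assms(2) by (auto simp: Pi_iff) (metis insertCI singletonD subsetD)
  then have "measure_pmf.prob (Pi_pmf V False (\<lambda>_. bernoulli_pmf p)) {\<omega>. \<forall>y\<in>U. \<omega> y} =
     (\<Prod>y\<in>V. if y \<in> U then p else 1)"
    using assms by (simp add: measure_Pi_pmf_Pi measure_pmf_single if_distrib cong: if_cong)
  also have "\<dots> = p ^ card (V \<inter> U)" using assms by (subst prod.If_cases) (auto simp: Int_def)
  also have "V \<inter> U = U" using assms by auto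
  finally show ?thesis .
qed

text \<open>Cells are rewarded and obstructions penalised in one expectation. Of the
  \<open>N^2 p\<close> expected cells at most a quarter is lost to large degrees, by
  \<open>\<kappa>_le\<close>, and at most a quarter to bad chains, by
  \<open>\<eta>_le\<close>.\<close>

lemma exists_treelike_cells:
  fixes p \<kappa> \<eta> :: real
  assumes p: "0 \<le> p" "p \<le> 1" and r: "r \<ge> 2" and M: "M \<ge> 1"
    and \<kappa>_def: "\<kappa> = real N ^ (2 * r - 2) * p ^ (r\<^sup>2 - 1)" and \<kappa>: "\<kappa> \<ge> 1"
    and \<kappa>_le: "4 * (real r)\<^sup>2 * \<kappa> \<le> real M ^ (r\<^sup>2 - 1)"
    and \<eta>: "\<And>a b. a \<in> {1..r} \<Longrightarrow> b \<in> {1..r} \<Longrightarrow> (a, b) \<noteq> (1, 1) \<Longrightarrow>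
      real N ^ (2 * r - a - b) * p ^ max 1 (r\<^sup>2 - a * b) \<le> \<eta>" and \<eta>0: "0 \<le> \<eta>"
    and \<eta>_le: "real (2 * M) * ((real r * real (2 * M))\<^sup>2 * \<kappa>) ^ (2 * M) * 4 ^ (r * (2 * M)) * \<eta> \<le> 1 / 4"
  shows "\<exists>S\<subseteq>{..<N} \<times> {..<N}. (real N)\<^sup>2 * p / 2 \<le> card S \<and>
    treelike_hypergraph S {A \<times> B | A B. card A = r \<and> card B = r \<and> A \<times> B \<subseteq> S} (r\<^sup>2 - 1) M"
proof -
  define V where "V = {..<N} \<times> {..<N}"
  define D where "D = real M ^ (r\<^sup>2 - 1)"
  define L where "L = good_lists N r 1"
  define Bad where "Bad = bad_lists N r (2 * M)"
  have finV: "finite V" by (simp add: V_def)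
  have D0: "D > 0" using M by (simp add: D_def)
  \<comment> \<open>Double counting allows at most \<open>r^2 / D\<close> cells of degree above
    \<open>D\<close> per present rectangle, hence this penalty; a bad chain costs the one cell that
    destroys it.\<close>
  define c where "c = (\<lambda>xs :: (nat set \<times> nat set) list. if xs \<in> L then - ((real r)\<^sup>2 / D) else - 1)"
  have disj: "L \<inter> Bad = {}" unfolding L_def Bad_def bad_lists_def good_lists_def by auto
  have finL: "finite L" "finite Bad" by (simp_all add: L_def Bad_def)
  define P where "P = Pi_pmf V False (\<lambda>_. bernoulli_pmf p)"
  define I where "I = Inl ` V \<union> Inr ` (L \<union> Bad)"
  define cc where "cc = case_sum (\<lambda>_ :: nat \<times> nat. 1 :: real) c"
  define ev where "ev = (\<lambda>i (\<omega> :: nat \<times> nat \<Rightarrow> bool). case i of Inl v \<Rightarrow> \<omega> v | Inr xs \<Rightarrow> (\<forall>y\<in>covered xs. \<omega> y))"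
  have sum_I: "(\<Sum>i\<in>I. cc i * h i) = (\<Sum>v\<in>V. h (Inl v)) - (real r)\<^sup>2 / D * (\<Sum>xs\<in>L. h (Inr xs)) - (\<Sum>xs\<in>Bad. h (Inr xs))"
    for h :: "(nat \<times> nat) + (nat set \<times> nat set) list \<Rightarrow> real"
  proof -
    have "(\<Sum>i\<in>I. cc i * h i) = (\<Sum>i\<in>Inl ` V. cc i * h i) + (\<Sum>i\<in>Inr ` (L \<union> Bad). cc i * h i)"
      unfolding I_def using finV finL by (intro sum.union_disjoint) auto
    also have "(\<Sum>i\<in>Inl ` V. cc i * h i) = (\<Sum>v\<in>V. h (Inl v))"
      by (subst sum.reindex) (auto simp: cc_def)
    also have "(\<Sum>i\<in>Inr ` (L \<union> Bad). cc i * h i) = (\<Sum>xs\<in>L \<union> Bad. c xs * h (Inr xs))"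
      by (subst sum.reindex) (auto simp: cc_def)
    also have "\<dots> = (\<Sum>xs\<in>L. c xs * h (Inr xs)) + (\<Sum>xs\<in>Bad. c xs * h (Inr xs))"
      using finL disj by (intro sum.union_disjoint) auto
    also have "(\<Sum>xs\<in>L. c xs * h (Inr xs)) = - ((real r)\<^sup>2 / D * (\<Sum>xs\<in>L. h (Inr xs)))"
      by (simp add: c_def sum_distrib_left sum_negf)
    also have "(\<Sum>xs\<in>Bad. c xs * h (Inr xs)) = (\<Sum>xs\<in>Bad. - h (Inr xs))"
      by (intro sum.cong refl) (use disj in \<open>auto simp: c_def\<close>)
    finally show ?thesis by (simp add: sum_negf)
  qed
  have cov_sub: "covered xs \<subseteq> V" if "xs \<in> L \<union> Bad" for xs
  proof -
    have "set xs \<subseteq> rects N r"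
      using that by (auto simp: L_def Bad_def bad_lists_def good_lists_def bad_steps_def dest!: good_set)
    then show ?thesis unfolding V_def by (rule covered_sub)
  qed
  have prob_cov: "measure_pmf.prob P {\<omega>. \<forall>y\<in>covered xs. \<omega> y} = p ^ card (covered xs)" if "xs \<in> L \<union> Bad" for xs
    unfolding P_def using cov_sub[OF that] by (intro prob_Pi_bernoulli_subset finV p)
  have prob_pt: "measure_pmf.prob P {\<omega>. \<omega> v} = p" if "v \<in> V" for v
    using prob_Pi_bernoulli_subset[OF finV, of "{v}" p] that p by (simp add: P_def)
  obtain \<omega> where \<omega>: "(\<Sum>i\<in>I. cc i * measure_pmf.prob P {\<omega>. ev i \<omega>}) \<le> (\<Sum>i\<in>I. cc i * of_bool (ev i \<omega>))"
    using exists_ge_expectation[of I cc P ev] finV finL unfolding I_def by blast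
  define S where "S = {v \<in> V. \<omega> v}"
  define X where "X = {x \<in> rects N r. cells x \<subseteq> S}"
  define Y where "Y = {xs \<in> Bad. covered xs \<subseteq> S}"
  have finS: "finite S" "finite X" "finite Y" using finV finL by (auto simp: S_def X_def Y_def)
  have sub_iff: "(\<forall>y\<in>covered xs. \<omega> y) \<longleftrightarrow> covered xs \<subseteq> S" if "xs \<in> L \<union> Bad" for xs
    using cov_sub[OF that] by (auto simp: S_def)
  have L_weight: "(\<Sum>xs\<in>L. p ^ card (covered xs)) \<le> (real N)\<^sup>2 * p * \<kappa>"
    unfolding L_def by (rule rect_weight[OF p r \<kappa>_def \<kappa>])
  have Bad_weight: "(\<Sum>xs\<in>Bad. p ^ card (covered xs)) \<le> (real N)\<^sup>2 * p / 4"
  proof -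
    have "(\<Sum>xs\<in>Bad. p ^ card (covered xs)) \<le> (real N)\<^sup>2 * p *
       (real (2 * M) * ((real r * real (2 * M))\<^sup>2 * \<kappa>) ^ (2 * M) * 4 ^ (r * (2 * M)) * \<eta>)"
      unfolding Bad_def by (rule bad_lists_weight[OF p r \<kappa>_def \<kappa> \<eta> \<eta>0])
    also have "\<dots> \<le> (real N)\<^sup>2 * p * (1 / 4)" using p \<eta>_le by (intro mult_left_mono) auto
    finally show ?thesis by simp
  qed
  have "(\<Sum>i\<in>I. cc i * measure_pmf.prob P {\<omega>. ev i \<omega>}) =
     (\<Sum>v\<in>V. p) - (real r)\<^sup>2 / D * (\<Sum>xs\<in>L. p ^ card (covered xs)) - (\<Sum>xs\<in>Bad. p ^ card (covered xs))"
    unfolding sum_I by (simp add: ev_def prob_cov prob_pt)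
  moreover have "(\<Sum>v\<in>V. p) = (real N)\<^sup>2 * p" by (simp add: V_def card_cartesian_product power2_eq_square)
  moreover have "(real r)\<^sup>2 / D * (\<Sum>xs\<in>L. p ^ card (covered xs)) \<le> (real N)\<^sup>2 * p / 4"
  proof -
    have "(real r)\<^sup>2 / D * (\<Sum>xs\<in>L. p ^ card (covered xs)) \<le> (real r)\<^sup>2 / D * ((real N)\<^sup>2 * p * \<kappa>)"
      using L_weight D0 by (intro mult_left_mono) auto
    also have "\<dots> = (real N)\<^sup>2 * p / 4 * (4 * (real r)\<^sup>2 * \<kappa> / D)" by simp
    also have "\<dots> \<le> (real N)\<^sup>2 * p / 4 * 1" using \<kappa>_le D0 p unfolding D_def[symmetric] by (intro mult_left_mono) auto
    finally show ?thesis by simp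
  qed
  ultimately have lower: "(real N)\<^sup>2 * p / 2 \<le> (\<Sum>i\<in>I. cc i * of_bool (ev i \<omega>))"
    using \<omega> Bad_weight by linarith
  have "(\<Sum>v\<in>V. of_bool (\<omega> v)) = real (card S)"
    using finV by (simp add: S_def Int_def)
  moreover have "(\<Sum>xs\<in>Bad. of_bool (\<forall>y\<in>covered xs. \<omega> y)) = real (card Y)"
    using finL sub_iff by (simp add: Y_def Int_def cong: conj_cong)
  moreover have "(\<Sum>xs\<in>L. of_bool (\<forall>y\<in>covered xs. \<omega> y)) = real (card X)"
  proof -
    have "(\<Sum>xs\<in>L. of_bool (\<forall>y\<in>covered xs. \<omega> y)) = (\<Sum>xs\<in>L. of_bool (covered xs \<subseteq> S) :: real)"
      by (intro sum.cong refl) (simp add: sub_iff)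
    also have "\<dots> = (\<Sum>x\<in>rects N r. of_bool (cells x \<subseteq> S))"
      unfolding L_def good_lists_1 by (subst sum.reindex) (auto simp: inj_on_def)
    also have "\<dots> = real (card X)" by (simp add: X_def Int_def)
    finally show ?thesis .
  qed
  ultimately have count: "(real N)\<^sup>2 * p / 2 \<le> card S - (real r)\<^sup>2 / D * card X - card Y"
    using lower unfolding sum_I by (simp add: ev_def)
  define Z1 where "Z1 = {v \<in> S. D < card {x \<in> X. v \<in> cells x}}"
  define pick where "pick = (\<lambda>xs :: (nat set \<times> nat set) list. SOME y. y \<in> cells (hd xs))"
  define Z2 where "Z2 = pick ` Y"
  define T where "T = S - Z1 - Z2"
  have "real (card Z1) * D = (\<Sum>v\<in>Z1. D)" by simp
  also have "\<dots> \<le> (\<Sum>v\<in>Z1. real (card {x \<in> X. v \<in> cells x}))" by (rule sum_mono) (simp add: Z1_def)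
  also have "\<dots> \<le> (\<Sum>v\<in>S. real (card {x \<in> X. v \<in> cells x}))"
    using finS by (intro sum_mono2) (auto simp: Z1_def)
  also have "\<dots> = (\<Sum>v\<in>S. \<Sum>x\<in>X. of_bool (v \<in> cells x))" using finS by (simp add: Int_def)
  also have "\<dots> = (\<Sum>x\<in>X. \<Sum>v\<in>S. of_bool (v \<in> cells x))" by (rule sum.swap)
  also have "\<dots> = (\<Sum>x\<in>X. (real r)\<^sup>2)"
  proof (rule sum.cong[OF refl])
    fix x assume x: "x \<in> X"
    then have "S \<inter> {v. v \<in> cells x} = cells x" by (auto simp: X_def)
    then have "(\<Sum>v\<in>S. of_bool (v \<in> cells x)) = real (card (cells x))" using finS by (simp only: sum_of_bool_eq)
    also have "card (cells x) = r\<^sup>2" using x rectsD[of x N r] by (simp add: X_def card_cartesian_product power2_eq_square)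
    finally show "(\<Sum>v\<in>S. of_bool (v \<in> cells x)) = (real r)\<^sup>2" by simp
  qed
  finally have "card Z1 * D \<le> (real r)\<^sup>2 * card X" by (simp add: mult.commute)
  then have Z1: "card Z1 \<le> (real r)\<^sup>2 / D * card X" using D0 by (simp add: field_simps)
  have Z2: "card Z2 \<le> card Y" unfolding Z2_def using finS by (intro card_image_le)
  have "card S \<le> card (T \<union> (Z1 \<union> Z2))"
    using finS by (intro card_mono) (auto simp: T_def Z1_def Z2_def)
  also have "\<dots> \<le> card T + (card Z1 + card Z2)"
    using card_Un_le[of T "Z1 \<union> Z2"] card_Un_le[of Z1 Z2] by linarith
  finally have cardT: "(real N)\<^sup>2 * p / 2 \<le> card T" using count Z1 Z2 by linarith
  define H where "H = {A \<times> B | A B. card A = r \<and> card B = r \<and> A \<times> B \<subseteq> T}"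
  have TV: "T \<subseteq> V" "T \<subseteq> S" by (auto simp: T_def S_def)
  have HT: "\<Union>H \<subseteq> T" by (auto simp: H_def)
  \<comment> \<open>Recovers the two sides from the cells of a hyperedge, which works because both
    sides are nonempty.\<close>
  define dec where "dec = (\<lambda>f :: (nat \<times> nat) set. (fst ` f, snd ` f))"
  have dec: "dec f \<in> X" "cells (dec f) = f" if f: "f \<in> H" for f
  proof -
    obtain A B where AB: "f = A \<times> B" "card A = r" "card B = r" "A \<times> B \<subseteq> T" using f unfolding H_def by blast
    have ne: "A \<noteq> {}" "B \<noteq> {}" using AB r by auto
    then have d: "dec f = (A, B)" by (simp add: dec_def AB)
    have "A \<subseteq> {..<N}" "B \<subseteq> {..<N}" using AB TV ne unfolding V_def by auto
    then show "dec f \<in> X" "cells (dec f) = f" using AB TV d by (auto simp: X_def rects_def)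
  qed
  have "treelike_hypergraph T H (r\<^sup>2 - 1) M"
  proof
    show "finite T" using TV finV finite_subset by blast
    show "\<Union>H \<subseteq> T" by (rule HT)
    show "card f = Suc (r\<^sup>2 - 1)" if "f \<in> H" for f
      using that r by (auto simp: H_def card_cartesian_product power2_eq_square)
    show "0 < M" using M by simp
    show "card {f \<in> H. v \<in> f} \<le> M ^ (r\<^sup>2 - 1)" if v: "v \<in> T" for v
    proof -
      have "card {f \<in> H. v \<in> f} \<le> card {x \<in> X. v \<in> cells x}"
        using finS dec by (intro card_inj_on_le[of dec]) (auto intro!: inj_on_inverseI[of _ cells])
      moreover have "\<not> D < card {x \<in> X. v \<in> cells x}" using v by (auto simp: T_def Z1_def)
      ultimately have "real (card {f \<in> H. v \<in> f}) \<le> real (M ^ (r\<^sup>2 - 1))" by (simp add: D_def)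
      then show ?thesis by (simp only: of_nat_le_iff)
    qed
    \<comment> \<open>Attaching the edges one at a time, a first non-corner attachment would produce
      a present bad chain. Its picked cell was deleted and yet belongs to the head, all of whose
      cells survive.\<close>
    have good: "good N r (map dec fs)"
      if "linked fs" "distinct fs" "set fs \<subseteq> H" "length fs \<le> 2 * M" for fs
      using that
    proof (induction fs)
      case (Cons f fs)
      have IH: "good N r (map dec fs)" using Cons by auto
      have f: "dec f \<in> X" "cells (dec f) = f" using Cons dec by auto
      have cov: "covered (map dec fs) = \<Union>(set fs)"
        using Cons.prems(3) dec(2) by (auto simp: covered_def)
      show ?case
      proof (cases "fs = []")
        case True then show ?thesis using f by (auto simp: X_def)
      next
        case False
        have touch: "cells (dec f) \<inter> covered (map dec fs) \<noteq> {}" using Cons.prems False f cov by auto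
        have fr: "dec f \<in> rects N r" using f by (simp add: X_def)
        have "corner_step (dec f) (map dec fs)"
        proof (rule ccontr)
          assume nc: "\<not> corner_step (dec f) (map dec fs)"
          \<comment> \<open>This is the case left out of \<open>bad_steps\<close>: a head without
            new cells already occurs in the chain, against distinctness.\<close>
          have "\<not> cells (dec f) \<subseteq> covered (map dec fs)"
          proof
            assume "cells (dec f) \<subseteq> covered (map dec fs)"
            then have "(fst (dec f), snd (dec f)) \<in> set (map dec fs)"
              using rectsD[OF fr] by (intro rect_in_good[OF r _ _ _ _ IH]) auto
            then obtain f' where f': "f' \<in> set fs" "dec f = dec f'" by auto
            then have "f = f'" using dec(2) f Cons.prems by (metis list.set_intros(2) subsetD)
            then show False using f' Cons.prems by simp
          qed
          then have "dec f \<in> bad_steps N r (map dec fs)" using touch nc fr by (simp add: bad_steps_def)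
          then have "dec f # map dec fs \<in> Bad"
            unfolding Bad_def bad_lists_def using IH Cons.prems False
            by (intro image_eqI[of _ _ "(map dec fs, dec f)"]) (auto simp: good_lists_def Suc_le_eq)
          moreover have "covered (dec f # map dec fs) \<subseteq> S"
          proof -
            have "covered (dec f # map dec fs) = \<Union>(set (f # fs))" using cov f(2) by simp
            also have "\<dots> \<subseteq> \<Union>H" using Cons.prems(3) by (rule Union_mono)
            finally show ?thesis using HT TV(2) by blast
          qed
          ultimately have "pick (dec f # map dec fs) \<in> Z2" unfolding Z2_def Y_def by blast
          moreover have "pick (dec f # map dec fs) \<in> f"
            unfolding pick_def using f touch by (simp add: some_in_eq) (metis Int_empty_left f(2) some_in_eq touch)
          moreover have "f \<subseteq> T" using Cons.prems by (auto simp: H_def)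
          ultimately show False by (auto simp: T_def)
        qed
        then show ?thesis using IH touch fr by simp
      qed
    qed simp
    show "acyclic_upto (2 * M) H"
      unfolding acyclic_upto_def
    proof (intro allI impI ballI)
      fix f fs x y
      assume a: "linked (f # fs) \<and> distinct (f # fs) \<and> set (f # fs) \<subseteq> H \<and> length (f # fs) \<le> 2 * M"
        and x: "x \<in> f \<inter> \<Union>(set fs)" and y: "y \<in> f \<inter> \<Union>(set fs)"
      have g: "good N r (map dec (f # fs))" by (rule good) (use a in auto)
      have cov: "covered (map dec fs) = \<Union>(set fs)" using a dec(2) by (auto simp: covered_def) blast+
      have f: "cells (dec f) = f" using a dec by auto
      have "fs \<noteq> []" using x by auto
      then have "corner_step (dec f) (map dec fs)" "cells (dec f) \<inter> covered (map dec fs) \<noteq> {}" using g by auto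
      then obtain a b where "cells (dec f) \<inter> covered (map dec fs) = {(a, b)}" by (rule corner_step_unique)
      then show "x = y" using x y unfolding f cov by auto
    qed
  qed
  then show ?thesis using cardT TV unfolding H_def V_def by blast
qed

section \<open>From cells to graphs\<close>

lemma (in treelike_hypergraph) exists_large_independent:
  assumes q: "q \<ge> 1" and \<theta>: "\<theta> = (ln (real M) / 4) powr (1 / q)" "\<theta> \<ge> 2"
  shows "\<exists>J\<subseteq>V. (\<forall>e\<in>H. \<not> e \<subseteq> J) \<and> real (card V) / M * (\<theta> / 4) \<le> card J"
proof -
  obtain J where J: "J \<subseteq> V" "\<forall>e\<in>H. \<not> e \<subseteq> J"
     "real (card V) / M * (\<Sum>i<M. pass_prob q M i * (1 - block_prob q M i ^ q)) \<le> card J"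
    using exists_independent by blast
  have "real (card V) / M * (\<theta> / 4) \<le> real (card V) / M * (\<Sum>i<M. pass_prob q M i * (1 - block_prob q M i ^ q))"
    using sum_pass_prob_lower[OF q _ \<theta>] M_pos by (intro mult_left_mono) auto
  also note J(3)
  finally show ?thesis using J(1,2) by blast
qed

text \<open>Rows stay in place and columns are shifted by \<open>N\<close>. A copy of the complete
  bipartite graph respects the two sides: one vertex fixes the side of the opposite class, which
  fixes the side of its own class.\<close>

lemma ex_Krr_ge_card:
  assumes J: "J \<subseteq> {..<N} \<times> {..<N}" and n: "2 * N \<le> n" and r: "r \<ge> 1"
    and free: "\<And>A B. card A = r \<Longrightarrow> card B = r \<Longrightarrow> \<not> A \<times> B \<subseteq> J"
  shows "card J \<le> ex_Krr n r"
proof -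
  define E where "E = (\<lambda>x y. (x < N \<and> N \<le> y \<and> (x, y - N) \<in> J) \<or> (y < N \<and> N \<le> x \<and> (y, x - N) \<in> J))"
  have simple: "simple_graph_on n E"
    using n by (auto simp: simple_graph_on_def E_def dest!: subsetD[OF J])
  have no_rect: False
    if A: "A \<noteq> {}" "card A = r" "card B = r" and sub: "\<And>a b. a \<in> A \<Longrightarrow> b \<in> B \<Longrightarrow> a < N \<and> N \<le> b \<and> (a, b - N) \<in> J" for A B
  proof -
    obtain a where "a \<in> A" using A(1) by blast
    then have "\<And>b. b \<in> B \<Longrightarrow> N \<le> b" using sub by blast
    then have "inj_on (\<lambda>b. b - N) B" by (intro inj_onI) (metis eq_diff_iff)
    then have "card ((\<lambda>b. b - N) ` B) = r" using A by (simp add: card_image)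
    moreover have "A \<times> (\<lambda>b. b - N) ` B \<subseteq> J" using sub by auto
    ultimately show False using free A(2) by blast
  qed
  have "\<not> contains_Krr n E r"
  proof
    assume "contains_Krr n E r"
    then obtain A B where AB: "card A = r" "card B = r" and e: "\<And>a b. a \<in> A \<Longrightarrow> b \<in> B \<Longrightarrow> E a b"
      unfolding contains_Krr_def by blast
    have ne: "A \<noteq> {}" "B \<noteq> {}" using AB r by auto
    then obtain a0 b0 where ab: "a0 \<in> A" "b0 \<in> B" by blast
    show False
    proof (cases "a0 < N")
      case True
      then have "N \<le> b" if "b \<in> B" for b using e[OF ab(1) that] by (auto simp: E_def)
      then have "a < N \<and> N \<le> b \<and> (a, b - N) \<in> J" if "a \<in> A" "b \<in> B" for a b
        using e[OF that] that by (auto simp: E_def not_less[symmetric])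
      then show False by (rule no_rect[OF ne(1) AB])
    next
      case False
      then have "b < N" if "b \<in> B" for b using e[OF ab(1) that] by (auto simp: E_def)
      then have "b < N \<and> N \<le> a \<and> (b, a - N) \<in> J" if "b \<in> B" "a \<in> A" for a b
        using e[OF that(2,1)] that by (auto simp: E_def not_less[symmetric])
      then show False by (rule no_rect[OF ne(2) AB(2,1)])
    qed
  qed
  moreover have fin: "finite (graph_edges n E')" "card (graph_edges n E') \<le> 2 ^ n" for E'
  proof -
    have "graph_edges n E' \<subseteq> Pow {..<n}" by (auto simp: graph_edges_def)
    then show "finite (graph_edges n E')" by (rule finite_subset) simp
    show "card (graph_edges n E') \<le> 2 ^ n"
      using card_mono[OF _ \<open>graph_edges n E' \<subseteq> Pow {..<n}\<close>] by (simp add: card_Pow)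
  qed
  define C where "C = {card (graph_edges n E) | E. simple_graph_on n E \<and> \<not> contains_Krr n E r}"
  have "finite C" by (rule finite_subset[of _ "{..2 ^ n}"]) (use fin in \<open>auto simp: C_def\<close>)
  ultimately have "card (graph_edges n E) \<le> Max C"
    using simple by (intro Max_ge) (auto simp: C_def)
  moreover have "card J \<le> card (graph_edges n E)"
  proof (rule card_inj_on_le[where f = "\<lambda>(a, b). {a, b + N}"])
    show "inj_on (\<lambda>(a, b). {a, b + N}) J"
      using J by (intro inj_onI) (auto simp: doubleton_eq_iff)
    show "(\<lambda>(a, b). {a, b + N}) ` J \<subseteq> graph_edges n E"
    proof clarify
      fix a b assume "(a, b) \<in> J"
      then have "a < n \<and> b + N < n \<and> E a (b + N)" using J n by (auto simp: E_def)
      then show "{a, b + N} \<in> graph_edges n E" unfolding graph_edges_def by blast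
    qed
  qed (rule fin)
  ultimately show ?thesis by (simp add: ex_Krr_def C_def)
qed

section \<open>Exponents and choice of parameters\<close>

text \<open>With \<open>s = a - 1\<close>, \<open>t = b - 1\<close>, \<open>u = r - 1\<close> the claim reads \<open>s (u - t) + t (u - s) \<ge> 2\<close>.\<close>

lemma rect_exponent:
  fixes a b r :: nat
  assumes r: "r \<ge> 3" and a: "a \<in> {1..r}" and b: "b \<in> {1..r}" and ne: "(a, b) \<noteq> (1, 1)" "(a, b) \<noteq> (r, r)"
  shows "(2 * real r - a - b) * (real r + 1) + 2 \<le> 2 * ((real r)\<^sup>2 - real a * b)"
proof -
  define s t u :: int where "s = int a - 1" and "t = int b - 1" and "u = int r - 1"
  have st: "0 \<le> s" "s \<le> u" "0 \<le> t" "t \<le> u" "2 \<le> u" using a b r by (auto simp: s_def t_def u_def)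
  have "2 \<le> s * (u - t) + t * (u - s)"
  proof (cases "s = 0 \<or> t = 0 \<or> s = u \<or> t = u")
    \<comment> \<open>On the boundary of the square one product vanishes and the other is a positive
      multiple of \<open>u \<ge> 2\<close>, the corners (0, 0) and (\<open>u\<close>,
      \<open>u\<close>) being excluded; in the interior both products are at least 1.\<close>
    case True
    have *: "2 \<le> x * u" if "x \<ge> 1" for x using mult_mono[of 1 x 2 u] that st by simp
    consider "s = 0" "t \<ge> 1" | "t = 0" "s \<ge> 1" | "s = u" "u - t \<ge> 1" | "t = u" "u - s \<ge> 1"
      using True ne st a b by (auto simp: s_def t_def u_def)
    then show ?thesis
    proof cases
      case 1 then show ?thesis using *[of t] by simp
    next
      case 2 then show ?thesis using *[of s] by simp
    next
      case 3 then show ?thesis using *[of "u - t"] by (simp add: mult.commute)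
    next
      case 4 then show ?thesis using *[of "u - s"] by (simp add: mult.commute)
    qed
  next
    case False
    then have "1 * 1 \<le> s * (u - t)" "1 * 1 \<le> t * (u - s)" using st by (intro mult_mono; simp)+
    then show ?thesis by simp
  qed
  then have "(2 * int r - a - b) * (int r + 1) + 2 \<le> 2 * ((int r)\<^sup>2 - int a * b)"
    unfolding s_def t_def u_def by (simp add: algebra_simps power2_eq_square)
  then have "real_of_int ((2 * int r - a - b) * (int r + 1) + 2) \<le> real_of_int (2 * ((int r)\<^sup>2 - int a * b))"
    unfolding of_int_le_iff .
  then show ?thesis by simp
qed

lemma eventually_weights_small:
  fixes c1 c2 c3 c4 c5 :: real
  assumes "c5 > 0"
  shows "eventually (\<lambda>x::real. ln (2 * x) + 2 * x * (c1 + c2 * ln x) + c3 * x + c4 * ln x - c5 * x ^ 2 \<le> ln (1 / 4)) at_top"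
  using assms by real_asymp

text \<open>Applied with \<open>m = r^2 - 1\<close>: halving the density saves \<open>2 ^ m\<close>
  in the degrees, which covers the factor \<open>4 r^2\<close> of the degree deletion.\<close>

lemma four_mult_le_power: "m \<ge> 5 \<Longrightarrow> 4 * (m + 1) \<le> (2::nat) ^ m"
  by (induction m rule: dec_induct) auto

text \<open>Both sides are compared as exponentials: \<open>small\<close> is the logarithm of the
  claim, with \<open>- c * M^2\<close> from \<open>\<eta>\<close> set against terms of order at most
  \<open>M\<close> ln \<open>M\<close> from the chains.\<close>

lemma weights_small:
  fixes r M :: nat and \<kappa> \<eta> c :: real
  assumes M: "M \<ge> 1" and r: "r \<ge> 1" and \<kappa>: "0 \<le> \<kappa>" "\<kappa> \<le> real M ^ (r\<^sup>2 - 1)"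
    and \<eta>: "0 \<le> \<eta>" "\<eta> \<le> real M ^ r\<^sup>2 * exp (- c * real M ^ 2)"
    and small: "ln (2 * real M) + 2 * real M * (ln (4 * (real r)\<^sup>2) + real (r\<^sup>2 + 1) * ln (real M)) +
      (2 * real r * ln 4) * real M + (real r)\<^sup>2 * ln (real M) - c * real M ^ 2 \<le> ln (1 / 4)"
  shows "real (2 * M) * ((real r * real (2 * M))\<^sup>2 * \<kappa>) ^ (2 * M) * 4 ^ (r * (2 * M)) * \<eta> \<le> 1 / 4"
proof -
  define x where "x = real M"
  have x: "x > 0" using M by (simp add: x_def)
  have pow: "x ^ n = exp (real n * ln x)" for n using x by (simp add: exp_of_nat_mult)
  define K where "K = 4 * (real r)\<^sup>2 * x ^ (r\<^sup>2 + 1)"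
  have "r\<^sup>2 \<ge> 1" using r by simp
  then have r2: "r\<^sup>2 + 1 = 2 + (r\<^sup>2 - 1)" by simp
  have "(real r * real (2 * M))\<^sup>2 * \<kappa> \<le> (real r * real (2 * M))\<^sup>2 * x ^ (r\<^sup>2 - 1)"
    using \<kappa> by (intro mult_left_mono) (auto simp: x_def)
  also have "\<dots> = K" unfolding K_def by (subst r2, subst power_add) (simp add: x_def power_mult_distrib)
  finally have "((real r * real (2 * M))\<^sup>2 * \<kappa>) ^ (2 * M) \<le> K ^ (2 * M)" using \<kappa> by (intro power_mono) auto
  then have "real (2 * M) * ((real r * real (2 * M))\<^sup>2 * \<kappa>) ^ (2 * M) * 4 ^ (r * (2 * M)) * \<eta> \<le>
      (2 * x) * K ^ (2 * M) * 4 ^ (r * (2 * M)) * (x ^ r\<^sup>2 * exp (- c * x ^ 2))"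
    using \<kappa> \<eta> x by (intro mult_mono) (auto simp: x_def K_def)
  also have "(2 * x) * K ^ (2 * M) * 4 ^ (r * (2 * M)) * (x ^ r\<^sup>2 * exp (- c * x ^ 2)) =
     exp (ln (2 * x) + 2 * x * (ln (4 * (real r)\<^sup>2) + real (r\<^sup>2 + 1) * ln x) +
      2 * real r * ln 4 * x + (real r)\<^sup>2 * ln x - c * x ^ 2)"
  proof -
    have "K = exp (ln (4 * (real r)\<^sup>2) + real (r\<^sup>2 + 1) * ln x)"
      unfolding K_def exp_add pow using r by simp
    then have "K ^ (2 * M) = exp (real (2 * M) * (ln (4 * (real r)\<^sup>2) + real (r\<^sup>2 + 1) * ln x))"
      by (simp only: exp_of_nat_mult)
    then have K: "K ^ (2 * M) = exp (2 * x * (ln (4 * (real r)\<^sup>2) + real (r\<^sup>2 + 1) * ln x))"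
      by (simp add: x_def)
    have "(4 :: real) ^ (r * (2 * M)) = exp (ln 4) ^ (r * (2 * M))" by simp
    also have "\<dots> = exp (real (r * (2 * M)) * ln 4)" by (rule exp_of_nat_mult[symmetric])
    finally have four: "(4 :: real) ^ (r * (2 * M)) = exp (2 * real r * ln 4 * x)" by (simp add: x_def mult_ac)
    have xr: "x ^ r\<^sup>2 = exp ((real r)\<^sup>2 * ln x)" unfolding pow by simp
    have two: "exp (ln (2 * x)) = 2 * x" using x by simp
    show ?thesis unfolding K four xr
      by (simp only: exp_add exp_diff exp_minus minus_mult_left[symmetric] mult.assoc divide_inverse two)
  qed
  also have "\<dots> \<le> exp (ln (1 / 4))" using small unfolding x_def exp_le_cancel_iff by simp
  finally show ?thesis by simp
qed

text \<open>The threshold concerns \<open>M\<close> alone, uniformly in \<open>N\<close>, because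
  the smallness conditions see \<open>N\<close> only through
  \<open>N powr - c \<le> exp (- c * M^2)\<close>.\<close>

lemma eventually_rectangle_free_cells:
  assumes r: "r \<ge> 5"
  shows "\<forall>\<^sub>F M in sequentially. \<forall>N. exp (real M ^ 2) \<le> real N \<longrightarrow>
    (\<exists>J\<subseteq>{..<N} \<times> {..<N}. (\<forall>A B. card A = r \<longrightarrow> card B = r \<longrightarrow> \<not> A \<times> B \<subseteq> J) \<and>
      real N powr (2 - 2 / (real r + 1)) * (ln (real M) / 4) powr (1 / (real r ^ 2 - 1)) / 16 \<le> card J)"
proof -
  define c where "c = 2 / (real r + 1)"
  define \<beta> where "\<beta> = 1 / (real r ^ 2 - 1)"
  have r2: "1 < real r ^ 2" using r by (simp add: one_less_power)
  have c: "c > 0" and \<beta>: "\<beta> > 0" using r r2 by (auto simp: c_def \<beta>_def)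
  have ev1: "\<forall>\<^sub>F x :: real in at_top. 2 \<le> (ln x / 4) powr \<beta>" using \<beta> by real_asymp
  have ev2: "\<forall>\<^sub>F x :: real in at_top. x * exp (- c * x ^ 2) \<le> 1" using c by real_asymp
  have ev3: "\<forall>\<^sub>F x :: real in at_top. x \<ge> 2" by real_asymp
  \<comment> \<open>The conditions secure, in this order, the range of
    \<open>sum_pass_prob_lower\<close>, \<open>p \<le> 1\<close>, \<open>\<kappa> \<ge> 1\<close>
    and the rarity of bad chains.\<close>
  note ev = eventually_conj[OF ev1 eventually_conj[OF ev2 eventually_conj[OF ev3
    eventually_weights_small[OF c, of "ln (4 * (real r)\<^sup>2)" "real (r\<^sup>2 + 1)" "2 * real r * ln 4" "(real r)\<^sup>2"]]]]
  show ?thesis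
  proof (rule eventually_mono[OF eventually_compose_filterlim[OF ev filterlim_real_sequentially]], intro allI impI)
    fix M N :: nat
    define x where "x = real M"
    assume "2 \<le> (ln (real M) / 4) powr \<beta> \<and> real M * exp (- c * (real M)\<^sup>2) \<le> 1 \<and> 2 \<le> real M \<and>
        ln (2 * real M) + 2 * real M * (ln (4 * (real r)\<^sup>2) + real (r\<^sup>2 + 1) * ln (real M)) +
        2 * real r * ln 4 * real M + (real r)\<^sup>2 * ln (real M) - c * (real M)\<^sup>2 \<le> ln (1 / 4)"
    then have \<theta>: "2 \<le> (ln (real M) / 4) powr \<beta>" and pM: "x * exp (- c * x\<^sup>2) \<le> 1" and x2: "2 \<le> x"
      and small: "ln (2 * real M) + 2 * real M * (ln (4 * (real r)\<^sup>2) + real (r\<^sup>2 + 1) * ln (real M)) +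
        (2 * real r * ln 4) * real M + (real r)\<^sup>2 * ln (real M) - c * real M ^ 2 \<le> ln (1 / 4)"
      unfolding x_def by auto
    assume NM: "exp (real M ^ 2) \<le> real N"
    then have N1: "1 \<le> real N" using one_le_exp_iff[of "real M ^ 2"] by (meson order_trans zero_le_power2)
    then have N0: "real N > 0" by simp
    have Npow: "real N ^ n = real N powr real n" for n using N0 by (simp add: powr_realpow)
    have Nc: "real N powr - c \<le> exp (- c * x\<^sup>2)"
    proof -
      have "real N powr - c \<le> exp (x\<^sup>2) powr - c"
        using NM c unfolding x_def by (intro powr_mono2') auto
      also have "\<dots> = exp (- c * x\<^sup>2)" by (simp add: powr_def)
      finally show ?thesis .
    qed
    \<comment> \<open>Since \<open>c * (r^2 - 1) = 2 * r - 2\<close>, the powers of \<open>N\<close>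
      in \<open>\<kappa>\<close> cancel and leave exactly \<open>(x / 2) ^ q\<close>.\<close>
    define p where "p = x / 2 * real N powr - c"
    define q where "q = r\<^sup>2 - 1"
    have "5\<^sup>2 \<le> r\<^sup>2" using r by (intro power_mono) auto
    then have q: "q \<ge> 1" "real q = real r ^ 2 - 1" "q \<ge> 5" "r\<^sup>2 = q + 1" by (auto simp: q_def of_nat_diff)
    have p0: "0 \<le> p" using x2 by (simp add: p_def)
    have "p \<le> x * exp (- c * x\<^sup>2)" unfolding p_def using Nc x2 by (intro mult_mono) auto
    then have p1: "p \<le> 1" using pM by linarith
    have ppow: "p ^ n = (x / 2) ^ n * real N powr (- c * real n)" for n
    proof -
      have "(real N powr - c) ^ n = real N powr (- c * real n)"
        using N0 by (simp add: powr_powr flip: powr_realpow)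
      then show ?thesis by (simp only: p_def power_mult_distrib)
    qed
    define \<kappa> where "\<kappa> = real N ^ (2 * r - 2) * p ^ (r\<^sup>2 - 1)"
    have \<kappa>: "\<kappa> = (x / 2) ^ q"
    proof -
      have "c * real q = real (2 * r - 2)"
        unfolding c_def q(2) using r by (simp add: field_simps of_nat_diff power2_eq_square)
      then have "\<kappa> = (x / 2) ^ q * (real N powr real (2 * r - 2) * real N powr (- real (2 * r - 2)))"
        unfolding \<kappa>_def ppow q_def[symmetric] Npow by simp
      also have "real N powr real (2 * r - 2) * real N powr (- real (2 * r - 2)) = 1"
        using N0 by (simp flip: powr_add)
      finally show ?thesis by simp
    qed
    have \<kappa>1: "\<kappa> \<ge> 1" unfolding \<kappa> using x2 by (intro one_le_power) auto
    have "real (4 * (q + 1)) \<le> real (2 ^ q)" unfolding of_nat_le_iff by (rule four_mult_le_power[OF q(3)])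
    moreover have "(real r)\<^sup>2 = real q + 1" using q(2) by simp
    ultimately have "4 * (real r)\<^sup>2 \<le> 2 ^ q" by simp
    then have "4 * (real r)\<^sup>2 * (x / 2) ^ q \<le> 2 ^ q * (x / 2) ^ q" using x2 by (intro mult_right_mono) auto
    then have \<kappa>M: "4 * (real r)\<^sup>2 * \<kappa> \<le> real M ^ (r\<^sup>2 - 1)"
      unfolding \<kappa> q_def[symmetric] by (simp add: x_def power_divide)
    have "1 * \<kappa> \<le> 4 * (real r)\<^sup>2 * \<kappa>" using \<kappa>1 r2 by (intro mult_right_mono) auto
    then have \<kappa>M1: "\<kappa> \<le> real M ^ (r\<^sup>2 - 1)" using \<kappa>M by simp
    define \<eta> where "\<eta> = x ^ r\<^sup>2 * real N powr - c"
    have \<eta>0: "0 \<le> \<eta>" using x2 by (simp add: \<eta>_def)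
    have \<eta>1: "\<eta> \<le> real M ^ r\<^sup>2 * exp (- c * real M ^ 2)"
      unfolding \<eta>_def using Nc x2 by (auto simp: x_def intro!: mult_left_mono)
    have \<eta>: "real N ^ (2 * r - a - b) * p ^ max 1 (r\<^sup>2 - a * b) \<le> \<eta>"
      if a: "a \<in> {1..r}" and b: "b \<in> {1..r}" and ne: "(a, b) \<noteq> (1, 1)" for a b
    proof -
      define e where "e = max 1 (r\<^sup>2 - a * b)"
      have ab: "a * b \<le> r\<^sup>2" using a b unfolding power2_eq_square by (intro mult_le_mono) auto
      have e: "e \<le> r\<^sup>2" using q(4) by (auto simp: e_def)
      \<comment> \<open>Strict 2-balancedness: after division by \<open>r + 1\<close>, the summand 2
        on the left becomes the saved factor \<open>N powr - c\<close>. For the full grid, the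
        single new cell \<open>e = 1\<close> gives equality.\<close>
      have le: "(2 * real r - a - b) * (real r + 1) + 2 \<le> 2 * real e"
      proof (cases "(a, b) = (r, r)")
        case False
        have "real r ^ 2 - real a * b = real (r\<^sup>2 - a * b)" using ab by (simp add: of_nat_diff)
        also have "\<dots> \<le> real e" by (simp add: e_def)
        finally have "2 * (real r ^ 2 - real a * b) \<le> 2 * real e" by simp
        then show ?thesis using rect_exponent[OF _ a b ne False] r by simp
      qed (simp add: e_def)
      have ex: "2 * real r - a - b - c * e \<le> - c"
      proof -
        have "2 * real r - a - b \<le> (2 * real e - 2) / (real r + 1)"
          using le by (subst pos_le_divide_eq) auto
        then show ?thesis by (simp add: c_def diff_divide_distrib)
      qed
      have "(x / 2) ^ e \<le> x ^ e" using x2 by (intro power_mono) auto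
      also have "\<dots> \<le> x ^ r\<^sup>2" using x2 e by (intro power_increasing) auto
      finally have xe: "(x / 2) ^ e \<le> x ^ r\<^sup>2" .
      have "real N ^ (2 * r - a - b) * p ^ e = (x / 2) ^ e * (real N powr real (2 * r - a - b) * real N powr (- c * e))"
        unfolding ppow Npow by simp
      also have "real N powr real (2 * r - a - b) * real N powr (- c * e) = real N powr (2 * real r - a - b - c * e)"
      proof -
        have "real (2 * r - a - b) + - c * e = 2 * real r - a - b - c * e" using a b by (simp add: of_nat_diff)
        then show ?thesis by (simp only: powr_add[symmetric])
      qed
      also have "(x / 2) ^ e * real N powr (2 * real r - a - b - c * e) \<le> x ^ r\<^sup>2 * real N powr - c"
        using xe ex N1 x2 by (intro mult_mono powr_mono) auto
      finally show ?thesis by (simp add: e_def \<eta>_def)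
    qed
    have M1: "M \<ge> 1" using x2 by (simp add: x_def)
    have "real (2 * M) * ((real r * real (2 * M))\<^sup>2 * \<kappa>) ^ (2 * M) * 4 ^ (r * (2 * M)) * \<eta> \<le> 1 / 4"
      using r \<kappa>1 by (intro weights_small[OF M1 _ _ \<kappa>M1 \<eta>0 \<eta>1 small]) auto
    then obtain S where S: "S \<subseteq> {..<N} \<times> {..<N}" "(real N)\<^sup>2 * p / 2 \<le> card S"
      "treelike_hypergraph S {A \<times> B | A B. card A = r \<and> card B = r \<and> A \<times> B \<subseteq> S} (r\<^sup>2 - 1) M"
      using exists_treelike_cells[OF p0 p1 _ M1 \<kappa>_def \<kappa>1 \<kappa>M \<eta> \<eta>0] r by auto
    define H where "H = {A \<times> B | A B. card A = r \<and> card B = r \<and> A \<times> B \<subseteq> S}"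
    interpret treelike_hypergraph S H q M using S(3) by (simp add: H_def q_def)
    define \<theta>' where "\<theta>' = (ln (real M) / 4) powr (1 / q)"
    have \<theta>': "\<theta>' = (ln (real M) / 4) powr \<beta>" by (simp add: \<theta>'_def q(2) \<beta>_def)
    obtain J where J: "J \<subseteq> S" "\<forall>e\<in>H. \<not> e \<subseteq> J" "real (card S) / M * (\<theta>' / 4) \<le> card J"
      using exists_large_independent[OF q(1) \<theta>'_def] \<theta> unfolding \<theta>' by auto
    \<comment> \<open>The factor \<open>M\<close> in the density cancels the \<open>1 / M\<close> of
      the chosen fraction, so only the gain \<open>\<theta>'\<close> remains; 16 collects the halves
      from \<open>p\<close> and from deletion and the quarter from the recursion.\<close>
    have "real N powr (2 - c) * \<theta>' / 16 = (real N)\<^sup>2 * p / 2 / M * (\<theta>' / 4)"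
    proof -
      have "real N powr (2 - c) = real N powr 2 * real N powr - c" by (simp only: powr_add[symmetric] diff_conv_add_uminus)
      also have "real N powr 2 = (real N)\<^sup>2" using N0 by simp
      finally show ?thesis using x2 by (simp add: p_def x_def field_simps)
    qed
    also have "\<dots> \<le> real (card S) / M * (\<theta>' / 4)"
      using S(2) \<theta> unfolding \<theta>' by (intro mult_right_mono divide_right_mono) auto
    also have "\<dots> \<le> card J" by (rule J(3))
    finally have "real N powr (2 - 2 / (real r + 1)) * (ln (real M) / 4) powr (1 / (real r ^ 2 - 1)) / 16 \<le> card J"
      by (simp add: c_def \<theta>' \<beta>_def)
    moreover have "\<not> A \<times> B \<subseteq> J" if "card A = r" "card B = r" for A B
      using J(1,2) that unfolding H_def by blast
    ultimately show "\<exists>J\<subseteq>{..<N} \<times> {..<N}. (\<forall>A B. card A = r \<longrightarrow> card B = r \<longrightarrow> \<not> A \<times> B \<subseteq> J) \<and>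
      real N powr (2 - 2 / (real r + 1)) * (ln (real M) / 4) powr (1 / (real r ^ 2 - 1)) / 16 \<le> card J"
      using J(1) S(1) by blast
  qed
qed

section \<open>Transfer to all large n\<close>

theorem theorem2:
  fixes r :: nat
  assumes "r \<ge> 5"
  shows "(\<lambda>n::nat. real (ex_Krr n r)) \<in>
           \<Omega>(\<lambda>n. real n powr (2 - 2 / (real r + 1)) * ln (ln (real n)) powr (1 / (real r ^ 2 - 1)))"
proof -
  define \<alpha> where "\<alpha> = 2 - 2 / (real r + 1)"
  define \<beta> where "\<beta> = 1 / (real r ^ 2 - 1)"
  have "1 < real r ^ 2" using assms by (simp add: one_less_power)
  then have \<alpha>: "\<alpha> > 0" and \<beta>: "\<beta> > 0" using assms by (auto simp: \<alpha>_def \<beta>_def field_simps)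
  define N where "N = (\<lambda>n :: nat. n div 2)"
  \<comment> \<open>Rounding down ensures \<open>exp (M n ^ 2) \<le> N n\<close>.\<close>
  define M where "M = (\<lambda>n :: nat. nat \<lfloor>sqrt (ln (real (N n)))\<rfloor>)"
  have N_lower: "\<forall>\<^sub>F n in sequentially. real n / 3 \<le> real (N n)"
    using eventually_ge_at_top[of 3] by eventually_elim (auto simp: N_def)
  have large: "\<forall>\<^sub>F n in sequentially. ln (real n) powr (1 / 4) \<le> sqrt (ln (real n / 3)) - 1"
    "\<forall>\<^sub>F n in sequentially. 1 < ln (real n)" "\<forall>\<^sub>F n in sequentially. 1 < real n / 3" by real_asymp+
  \<comment> \<open>Only \<open>ln (M n)\<close> enters the bound, so a fixed power of
    \<open>ln n\<close> below \<open>M n\<close> suffices: its exponent \<open>1 / 4\<close> becomes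
    a constant factor.\<close>
  have M_lower: "\<forall>\<^sub>F n in sequentially. ln (real n) powr (1 / 4) \<le> real (M n)"
    using N_lower large
  proof eventually_elim
    case (elim n)
    have "ln (real n / 3) \<le> ln (real (N n))" using elim by (subst ln_le_cancel_iff) auto
    then have "sqrt (ln (real n / 3)) \<le> sqrt (ln (real (N n)))" by simp
    then show ?case using elim unfolding M_def by linarith
  qed
  have "filterlim (\<lambda>n. ln (real n) powr (1 / 4)) at_top sequentially" by real_asymp
  then have "filterlim (\<lambda>n. real (M n)) at_top sequentially"
    using M_lower by (rule filterlim_at_top_mono)
  then have "filterlim M sequentially sequentially"
    by (simp add: filterlim_sequentially_iff_filterlim_real)
  note J = eventually_compose_filterlim[OF eventually_rectangle_free_cells[OF assms] this]
  have "\<forall>\<^sub>F n in sequentially. (1 / 3) powr \<alpha> * (1 / 16) powr \<beta> / 16 *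
      (real n powr \<alpha> * ln (ln (real n)) powr \<beta>) \<le> real (ex_Krr n r)"
    using J N_lower large(2,3) M_lower
  proof eventually_elim
    case (elim n)
    have N1: "1 < real (N n)" using elim by linarith
    then have lnN: "0 < ln (real (N n))" by simp
    have "real (M n) \<le> sqrt (ln (real (N n)))" using lnN unfolding M_def by simp
    then have "real (M n) ^ 2 \<le> sqrt (ln (real (N n))) ^ 2" by (intro power_mono) auto
    then have "real (M n) ^ 2 \<le> ln (real (N n))" using lnN by simp
    then have "exp (real (M n) ^ 2) \<le> exp (ln (real (N n)))" by simp
    then have "exp (real (M n) ^ 2) \<le> real (N n)" using N1 by simp
    then obtain J where J: "J \<subseteq> {..<N n} \<times> {..<N n}"
      "\<And>A B. card A = r \<Longrightarrow> card B = r \<Longrightarrow> \<not> A \<times> B \<subseteq> J"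
      "real (N n) powr \<alpha> * (ln (real (M n)) / 4) powr \<beta> / 16 \<le> card J"
      using elim(1) unfolding \<alpha>_def \<beta>_def by blast
    have "card J \<le> ex_Krr n r"
      using assms by (intro ex_Krr_ge_card[OF J(1) _ _ J(2)]) (auto simp: N_def)
    then have J': "real (N n) powr \<alpha> * (ln (real (M n)) / 4) powr \<beta> / 16 \<le> real (ex_Krr n r)"
      using J(3) by linarith
    have "ln (ln (real n)) / 4 = ln (ln (real n) powr (1 / 4))" using elim by (simp add: ln_powr)
    also have "\<dots> \<le> ln (real (M n))" using elim by (intro ln_mono) auto
    finally have lnM: "ln (ln (real n)) / 16 \<le> ln (real (M n)) / 4" by simp
    have lnln: "0 \<le> ln (ln (real n))" using elim by simp
    have "(1 / 3) powr \<alpha> * (1 / 16) powr \<beta> / 16 * (real n powr \<alpha> * ln (ln (real n)) powr \<beta>) =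
        (real n / 3) powr \<alpha> * (ln (ln (real n)) / 16) powr \<beta> / 16"
      using lnln by (simp add: powr_divide)
    also have "\<dots> \<le> real (N n) powr \<alpha> * (ln (real (M n)) / 4) powr \<beta> / 16"
      using lnM lnln elim \<alpha> \<beta> by (intro divide_right_mono mult_mono powr_mono2) auto
    finally show ?case using J' by linarith
  qed
  then show ?thesis
    unfolding \<alpha>_def[symmetric] \<beta>_def[symmetric]
    by (intro landau_omega.bigI[where c = "(1 / 3) powr \<alpha> * (1 / 16) powr \<beta> / 16"]) (auto elim!: eventually_mono)
qed

end
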